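(* Let $(C,b,T_{\mathsf d},T_{\mathsf u})$ be an oriented quantum coalgebra over the field $k$ and suppose that the coalgebra $C$ is cocommutative. Then $$\mathbf{Inv}_C(\mathbf T)(c)=b^{\,\mathrm{writhe}\,\mathbf T}(c_{(1)},c_{(2)})$$ for all oriented $1$--$1$ tangle diagrams $\mathbf T\in\mathbf{Tang}$ and all $c\in C$. Thus, whenever $\mathbf T,\mathbf T'\in\mathbf{Tang}$ satisfy $\mathrm{writhe}\,\mathbf T=\mathrm{writhe}\,\mathbf T'$, then $\mathbf{Inv}_C(\mathbf T)=\mathbf{Inv}_C(\mathbf T')$.
   Context: $k$ is a field. For a coalgebra $(C,\Delta,\epsilon)$ over $k$ write $\Delta(c)=c_{(1)}\otimes c_{(2)}$ and, for iterated coproducts, $\Delta^{(m-1)}(c)=c_{(1)}\otimes\cdots\otimes c_{(m)}$ (summation understood). A bilinear form $b:C\times C\to k$ is invertible, with inverse $b^{-1}$, if $b^{-1}(c_{(1)},d_{(1)})b(c_{(2)},d_{(2)})=\epsilon(c)\epsilon(d)=b(c_{(1)},d_{(1)})b^{-1}(c_{(2)},d_{(2)})$ for all $c,d\in C$. For an integer $m$, $b^m$ denotes the $m$-th convolution power of $b$ (product of bilinear forms $(bb')(c,d)=b(c_{(1)},d_{(1)})b'(c_{(2)},d_{(2)})$), with $b^0(c,d)=\epsilon(c)\epsilon(d)$. $C^*$ is the linear dual of $C$. $C$ is cocommutative if $c_{(1)}\otimes c_{(2)}=c_{(2)}\otimes c_{(1)}$ for all $c\in C$. A linear automorphism $T$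 of $C$ is a coalgebra automorphism of $C$ with respect to a set $\mathcal S$ of bilinear forms on $C$ if $\epsilon\circ T=\epsilon$ and $b(T(c_{(1)}),d)\,b'(T(c_{(2)}),e)=b(T(c)_{(1)},d)\,b'(T(c)_{(2)},e)$ and $b(d,T(c_{(1)}))\,b'(e,T(c_{(2)}))=b(d,T(c)_{(1)})\,b'(e,T(c)_{(2)})$ for all $b,b'\in\mathcal S$ and $c,d,e\in C$. An oriented quantum coalgebra over $k$ is a quadruple $(C,b,T_{\mathsf d},T_{\mathsf u})$ where $C$ is a coalgebra over $k$, $b:C\times C\to k$ is an invertible bilinear form and $T_{\mathsf d},T_{\mathsf u}$ are commuting coalgebra automorphisms of $C$ with respect to $\{b,b^{-1}\}$ such that for all $c,d,e\in C$: (qc.1) $b(c_{(1)},T_{\mathsf u}(d_{(2)}))\,b^{-1}(T_{\mathsf d}(c_{(2)}),d_{(1)})=\epsilon(c)\epsilon(d)$ and $b^{-1}(T_{\mathsf d}(c_{(1)}),d_{(2)})\,b(c_{(2)},T_{\mathsf u}(d_{(1)}))=\epsilon(c)\epsilon(d)$; (qc.2) $b(c,d)=b(T_{\mathsf d}(c),T_{\mathsf d}(d))=b(T_{\mathsf u}(c),T_{\mathsf u}(d))$; (qc.3) $b(c_{(1)},d_{(1)})b(c_{(2)},e_{(1)})b(d_{(2)},e_{(2)})=b(c_{(2)},d_{(2)})b(c_{(1)},e_{(2)})b(d_{(1)},e_{(1)})$. Tangle diagrams. $\mathbf{Tang}$ is the set of oriented $1$--$1$ tangle diagrams: planar diagrams,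 drawn with respect to the vertical direction, of a single oriented strand contained in a box except for two protruding vertical end segments, one at the top and one at the bottom. Each is composed of crossings, local maxima, local minima and "vertical" lines, with compatible orientations. Each crossing consists of two crossing lines, one joining its SW and NE corners and the other joining its NW and SE corners; one is the over line and the other the under line. The strand is traversed in the direction of orientation from the base point (beginning) to the end point. Types of oriented local extrema: $(\mathsf u_-)$ a local maximum traversed from left to right (clockwise); $(\mathsf u_+)$ a local minimum traversed from left to right (counterclockwise); $(\mathsf d_+)$ a local maximum traversed from right to left (counterclockwise); $(\mathsf d_-)$ a local minimum traversed from right to left (clockwise). Definition of $\mathbf{Inv}_C:\mathbf{Tang}\to C^*$. If $\mathbf T$ has no crossings, $\mathbf{Inv}_C(\mathbf T)=\epsilon$. If $\mathbf T$ has $n\ge1$ crossings, traverse $\mathbf T$ from its base point and label the crossing lines $1,\dots,2n$ in the order encountered. For $1\le\imath\le2n$ let $u_{\mathsf d}(\imath)$ be the number of extrema of type $(\mathsf d_+)$ minus the number of type $(\mathsf d_-)$ encountered on the portion of the traversal from line $\imath$ to the end, and let $u_{\mathsf u}(\imath)$ be defined likewise with $(\mathsf u_+),(\mathsf u_-)$. Write $[\imath;p,q]=T_{\mathsf d}^{u_{\mathsf d}(\imath)+p}\circ T_{\mathsf u}^{u_{\mathsf u}(\imath)+q}(c_{(\imath)})$. For $c\in C$, with $\Delta^{(2n-1)}(c)=c_{(1)}\otimes\cdots\otimes c_{(2n)}$, the scalar $\mathbf{Inv}_C(\mathbf T)(c)$ is the (Sweedler sum of the) product over all crossings of the following factors,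 where $\imath$ labels the over line and $\jmath$ the under line: - over line SW--NE, both lines directed upward, or both directed downward: $b([\imath;0,0],[\jmath;0,0])$; - over line SW--NE, both lines directed left to right: $b^{-1}([\imath;0,1],[\jmath;0,0])$; - over line SW--NE, both lines directed right to left: $b^{-1}([\imath;1,0],[\jmath;0,0])$; - over line NW--SE, both lines directed upward, or both directed downward: $b^{-1}([\imath;0,0],[\jmath;0,0])$; - over line NW--SE, both lines directed left to right: $b([\imath;0,0],[\jmath;0,1])$; - over line NW--SE, both lines directed right to left: $b([\imath;0,0],[\jmath;1,0])$. Writhe. The sign of an oriented crossing is $1$ if, as the under line is traversed in the direction of orientation, the direction of the over line is to the right; otherwise it is $-1$. $\mathrm{writhe}\,\mathbf T$ is the sum of the signs of the crossings of $\mathbf T$ ($0$ if there are none). *)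

theory Defs
  imports Complex_Main "HOL-Library.Poly_Mapping"
begin

section \<open>Formal tensors\<close>

text \<open>
  The finitely supported functions on words over \<open>'c\<close> form the free vector space on these words.
  A word \<open>[x\<^sub>1, \<dots>, x\<^sub>m]\<close> stands for the pure tensor \<open>x\<^sub>1 \<otimes> \<dots> \<otimes> x\<^sub>m\<close>; dividing by the relations
  of multilinearity gives the tensor algebra of \<open>'c\<close>, whose part spanned by the words of length
  \<open>m\<close> is the \<open>m\<close>-th tensor power.  An element of a tensor power is handled through a
  representative in the free space (this is Sweedler's sum), and equality of tensors is the
  congruence \<open>tensor_eq\<close>.
\<close>

type_synonym ('k, 'c) formal_tensor = "'c list \<Rightarrow>\<^sub>0 'k"

definition ft_scale :: "'k::field \<Rightarrow> ('w \<Rightarrow>\<^sub>0 'k) \<Rightarrow> ('w \<Rightarrow>\<^sub>0 'k)" where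
  "ft_scale r s = Poly_Mapping.map ((*) r) s"

lemma lookup_ft_scale [simp]:
  "Poly_Mapping.lookup (ft_scale r s) w = r * Poly_Mapping.lookup s w"
  by (simp add: ft_scale_def Poly_Mapping.map.rep_eq when_def)

interpretation ft: vector_space ft_scale
  by unfold_locales (auto intro!: poly_mapping_eqI simp: lookup_add algebra_simps)

abbreviation pure :: "'c list \<Rightarrow> ('k::field, 'c) formal_tensor" where
  "pure w \<equiv> Poly_Mapping.single w 1"

definition tensor_relations ::
  "('k::field \<Rightarrow> 'c::ab_group_add \<Rightarrow> 'c) \<Rightarrow> ('k, 'c) formal_tensor set" where
  "tensor_relations scale =
     {pure (xs @ [x + y] @ ys) - pure (xs @ [x] @ ys) - pure (xs @ [y] @ ys) | xs ys x y. True} \<union>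
     {pure (xs @ [scale r x] @ ys) - ft_scale r (pure (xs @ [x] @ ys)) | xs ys r x. True}"

definition tensor_eq ::
  "('k::field \<Rightarrow> 'c::ab_group_add \<Rightarrow> 'c) \<Rightarrow> ('k, 'c) formal_tensor \<Rightarrow> ('k, 'c) formal_tensor \<Rightarrow> bool"
  where "tensor_eq scale s t \<longleftrightarrow> s - t \<in> ft.span (tensor_relations scale)"

text \<open>Linear extension to the free vector space of a map given on words.\<close>

definition lin_ext :: "('k::field \<Rightarrow> 'v::ab_group_add \<Rightarrow> 'v) \<Rightarrow> ('w \<Rightarrow> 'v) \<Rightarrow> ('w \<Rightarrow>\<^sub>0 'k) \<Rightarrow> 'v" where
  "lin_ext scale f s = (\<Sum>w\<in>Poly_Mapping.keys s. scale (Poly_Mapping.lookup s w) (f w))"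


section \<open>Coalgebras\<close>

record (overloaded) ('k, 'c) coalg =
  smult :: "'k::field \<Rightarrow> 'c \<Rightarrow> 'c"
  comult :: "'c \<Rightarrow> ('k, 'c) formal_tensor"
  counit :: "'c \<Rightarrow> 'k"

text \<open>\<open>comult_at C p\<close> applies the coproduct to the tensor factor at position \<open>p\<close>.\<close>

definition comult_at ::
  "('k::field, 'c) coalg \<Rightarrow> nat \<Rightarrow> ('k, 'c) formal_tensor \<Rightarrow> ('k, 'c) formal_tensor" where
  "comult_at C p = lin_ext ft_scale (\<lambda>w.
     lin_ext ft_scale (\<lambda>u. pure (take p w @ u @ drop (Suc p) w)) (comult C (w ! p)))"

locale coalgebra = vector_space "smult C" for C :: "('k::field, 'c::ab_group_add) coalg" +
  assumes comult_degree: "w \<in> Poly_Mapping.keys (comult C c) \<Longrightarrow> length w = 2"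
    and comult_add: "tensor_eq (smult C) (comult C (c + d)) (comult C c + comult C d)"
    and comult_scale: "tensor_eq (smult C) (comult C (smult C r c)) (ft_scale r (comult C c))"
    and counit_linear: "Vector_Spaces.linear (smult C) (*) (counit C)"
    and coassoc: "tensor_eq (smult C) (comult_at C 0 (comult C c)) (comult_at C 1 (comult C c))"
    and counit_left: "lin_ext (smult C) (\<lambda>w. smult C (counit C (w ! 0)) (w ! 1)) (comult C c) = c"
    and counit_right: "lin_ext (smult C) (\<lambda>w. smult C (counit C (w ! 1)) (w ! 0)) (comult C c) = c"

definition cocommutative :: "('k::field, 'c::ab_group_add) coalg \<Rightarrow> bool" where
  "cocommutative C \<longleftrightarrow>
     (\<forall>c. tensor_eq (smult C) (comult C c) (lin_ext ft_scale (\<lambda>w. pure [w ! 1, w ! 0]) (comult C c)))"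

text \<open>\<open>comult_iter C m\<close> is the iterated coproduct with \<open>m + 1\<close> tensor factors.\<close>

primrec comult_iter :: "('k::field, 'c) coalg \<Rightarrow> nat \<Rightarrow> 'c \<Rightarrow> ('k, 'c) formal_tensor" where
  "comult_iter C 0 c = pure [c]"
| "comult_iter C (Suc m) c = comult_at C 0 (comult_iter C m c)"

text \<open>\<open>sweedler C c f\<close> is the sum \<open>f(c\<^sub>(\<^sub>1\<^sub>), c\<^sub>(\<^sub>2\<^sub>))\<close>, where \<open>f\<close> is bilinear.\<close>

definition sweedler :: "('k::field, 'c) coalg \<Rightarrow> 'c \<Rightarrow> ('c \<Rightarrow> 'c \<Rightarrow> 'k) \<Rightarrow> 'k" where
  "sweedler C c f = lin_ext (*) (\<lambda>w. f (w ! 0) (w ! 1)) (comult C c)"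


section \<open>Bilinear forms\<close>

definition bilinear_form :: "('k::field, 'c::ab_group_add) coalg \<Rightarrow> ('c \<Rightarrow> 'c \<Rightarrow> 'k) \<Rightarrow> bool" where
  "bilinear_form C b \<longleftrightarrow>
     (\<forall>d. Vector_Spaces.linear (smult C) (*) (\<lambda>c. b c d)) \<and>
     (\<forall>c. Vector_Spaces.linear (smult C) (*) (\<lambda>d. b c d))"

definition conv ::
  "('k::field, 'c) coalg \<Rightarrow> ('c \<Rightarrow> 'c \<Rightarrow> 'k) \<Rightarrow> ('c \<Rightarrow> 'c \<Rightarrow> 'k) \<Rightarrow> 'c \<Rightarrow> 'c \<Rightarrow> 'k" where
  "conv C b b' c d = sweedler C c (\<lambda>c1 c2. sweedler C d (\<lambda>d1 d2. b c1 d1 * b' c2 d2))"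

definition conv_one :: "('k::field, 'c) coalg \<Rightarrow> 'c \<Rightarrow> 'c \<Rightarrow> 'k" where
  "conv_one C c d = counit C c * counit C d"

definition is_conv_inverse ::
  "('k::field, 'c::ab_group_add) coalg \<Rightarrow> ('c \<Rightarrow> 'c \<Rightarrow> 'k) \<Rightarrow> ('c \<Rightarrow> 'c \<Rightarrow> 'k) \<Rightarrow> bool" where
  "is_conv_inverse C b b' \<longleftrightarrow>
     bilinear_form C b' \<and> conv C b' b = conv_one C \<and> conv C b b' = conv_one C"

definition conv_invertible :: "('k::field, 'c::ab_group_add) coalg \<Rightarrow> ('c \<Rightarrow> 'c \<Rightarrow> 'k) \<Rightarrow> bool" where
  "conv_invertible C b \<longleftrightarrow> (\<exists>b'. is_conv_inverse C b b')"

definition conv_inv ::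
  "('k::field, 'c::ab_group_add) coalg \<Rightarrow> ('c \<Rightarrow> 'c \<Rightarrow> 'k) \<Rightarrow> ('c \<Rightarrow> 'c \<Rightarrow> 'k)" where
  "conv_inv C b = (THE b'. is_conv_inverse C b b')"

primrec conv_npow :: "('k::field, 'c) coalg \<Rightarrow> ('c \<Rightarrow> 'c \<Rightarrow> 'k) \<Rightarrow> nat \<Rightarrow> 'c \<Rightarrow> 'c \<Rightarrow> 'k" where
  "conv_npow C b 0 = conv_one C"
| "conv_npow C b (Suc n) = conv C b (conv_npow C b n)"

definition conv_pow ::
  "('k::field, 'c::ab_group_add) coalg \<Rightarrow> ('c \<Rightarrow> 'c \<Rightarrow> 'k) \<Rightarrow> int \<Rightarrow> 'c \<Rightarrow> 'c \<Rightarrow> 'k" where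
  "conv_pow C b m =
     (if m \<ge> 0 then conv_npow C b (nat m) else conv_npow C (conv_inv C b) (nat (- m)))"


section \<open>Oriented quantum coalgebras\<close>

definition coalgebra_automorphism ::
  "('k::field, 'c::ab_group_add) coalg \<Rightarrow> ('c \<Rightarrow> 'c \<Rightarrow> 'k) set \<Rightarrow> ('c \<Rightarrow> 'c) \<Rightarrow> bool" where
  "coalgebra_automorphism C S T \<longleftrightarrow>
     Vector_Spaces.linear (smult C) (smult C) T \<and> bij T \<and> counit C \<circ> T = counit C \<and>
     (\<forall>b\<in>S. \<forall>b'\<in>S. \<forall>c d e.
        sweedler C c (\<lambda>c1 c2. b (T c1) d * b' (T c2) e) =
          sweedler C (T c) (\<lambda>t1 t2. b t1 d * b' t2 e) \<and>
        sweedler C c (\<lambda>c1 c2. b d (T c1) * b' e (T c2)) =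
          sweedler C (T c) (\<lambda>t1 t2. b d t1 * b' e t2))"

locale oriented_quantum_coalgebra = coalgebra C
  for C :: "('k::field, 'c::ab_group_add) coalg" +
  fixes b :: "'c \<Rightarrow> 'c \<Rightarrow> 'k" and Td Tu :: "'c \<Rightarrow> 'c"
  assumes bilinear: "bilinear_form C b"
    and invertible: "conv_invertible C b"
    and automorphism_Td: "coalgebra_automorphism C {b, conv_inv C b} Td"
    and automorphism_Tu: "coalgebra_automorphism C {b, conv_inv C b} Tu"
    and commute: "Td \<circ> Tu = Tu \<circ> Td"
    and qc1:
      "sweedler C c (\<lambda>c1 c2. sweedler C d (\<lambda>d1 d2. b c1 (Tu d2) * conv_inv C b (Td c2) d1)) =
         counit C c * counit C d"
      "sweedler C c (\<lambda>c1 c2. sweedler C d (\<lambda>d1 d2. conv_inv C b (Td c1) d2 * b c2 (Tu d1))) =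
         counit C c * counit C d"
    and qc2: "b c d = b (Td c) (Td d)" "b c d = b (Tu c) (Tu d)"
    and qc3:
      "sweedler C c (\<lambda>c1 c2. sweedler C d (\<lambda>d1 d2. sweedler C e (\<lambda>e1 e2.
          b c1 d1 * b c2 e1 * b d2 e2))) =
       sweedler C c (\<lambda>c1 c2. sweedler C d (\<lambda>d1 d2. sweedler C e (\<lambda>e1 e2.
          b c2 d2 * b c1 e2 * b d1 e1)))"


section \<open>Oriented 1-1 tangle diagrams\<close>

text \<open>
  A diagram is cut by horizontal levels into rows, listed from bottom to top, and each row is a
  list from left to right of oriented elementary pieces: vertical lines, local extrema and
  crossings.  In \<open>Crossing l d e\<close>, \<open>l\<close> is the over line, \<open>d\<close> is the vertical direction of the line
  SW--NE and \<open>e\<close> the vertical direction of the line NW--SE.  Extrema carry the horizontal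
  direction in which they are traversed.
\<close>

datatype vdir = Up | Down
datatype hdir = Rightwards | Leftwards
datatype diagonal = SWNE | NWSE
datatype piece =
    Vertical vdir
  | Maximum hdir
  | Minimum hdir
  | Crossing diagonal vdir vdir

type_synonym diagram = "piece list list"

text \<open>The directions of the strand at the lower and at the upper end points of a piece.\<close>

fun lower_ends :: "piece \<Rightarrow> vdir list" where
  "lower_ends (Vertical d) = [d]"
| "lower_ends (Maximum Rightwards) = [Up, Down]"
| "lower_ends (Maximum Leftwards) = [Down, Up]"
| "lower_ends (Minimum h) = []"
| "lower_ends (Crossing l d e) = [d, e]"

fun upper_ends :: "piece \<Rightarrow> vdir list" where
  "upper_ends (Vertical d) = [d]"
| "upper_ends (Maximum h) = []"
| "upper_ends (Minimum Rightwards) = [Down, Up]"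
| "upper_ends (Minimum Leftwards) = [Up, Down]"
| "upper_ends (Crossing l d e) = [e, d]"

definition row_lower :: "piece list \<Rightarrow> vdir list" where
  "row_lower r = concat (map lower_ends r)"

definition row_upper :: "piece list \<Rightarrow> vdir list" where
  "row_upper r = concat (map upper_ends r)"

definition compatible :: "diagram \<Rightarrow> bool" where
  "compatible D \<longleftrightarrow> D \<noteq> [] \<and>
     (\<forall>h. Suc h < length D \<longrightarrow> row_upper (D ! h) = row_lower (D ! Suc h)) \<and>
     length (row_lower (hd D)) = 1 \<and> length (row_upper (last D)) = 1"

text \<open>
  A location \<open>(h, p)\<close> is the \<open>p\<close>-th piece of row \<open>h\<close>.  The strand consists of segments: one for each
  piece which is not a crossing, and the two crossing lines of each crossing.
\<close>

type_synonym location = "nat \<times> nat"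

datatype segment = Arc location | Line location diagonal

definition locations :: "diagram \<Rightarrow> location set" where
  "locations D = {(h, p). h < length D \<and> p < length (D ! h)}"

definition piece_at :: "diagram \<Rightarrow> location \<Rightarrow> piece" where
  "piece_at D x = D ! fst x ! snd x"

definition crossings :: "diagram \<Rightarrow> location set" where
  "crossings D = {x \<in> locations D. \<exists>l d e. piece_at D x = Crossing l d e}"

definition segments :: "diagram \<Rightarrow> segment set" where
  "segments D = Arc ` (locations D - crossings D) \<union> {Line x l | x l. x \<in> crossings D}"

text \<open>
  The point \<open>(h, i)\<close> is the \<open>i\<close>-th point from the left on the level below row \<open>h\<close>.
  \<open>ends D s\<close> is the pair of the initial and the final point of the oriented segment \<open>s\<close>.
\<close>

definition directed :: "vdir \<Rightarrow> 'p \<Rightarrow> 'p \<Rightarrow> 'p \<times> 'p" where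
  "directed d p q = (case d of Up \<Rightarrow> (p, q) | Down \<Rightarrow> (q, p))"

definition lower_point :: "diagram \<Rightarrow> location \<Rightarrow> nat \<Rightarrow> nat \<times> nat" where
  "lower_point D x i = (case x of (h, p) \<Rightarrow> (h, length (row_lower (take p (D ! h))) + i))"

definition upper_point :: "diagram \<Rightarrow> location \<Rightarrow> nat \<Rightarrow> nat \<times> nat" where
  "upper_point D x i = (case x of (h, p) \<Rightarrow> (Suc h, length (row_upper (take p (D ! h))) + i))"

fun ends :: "diagram \<Rightarrow> segment \<Rightarrow> (nat \<times> nat) \<times> (nat \<times> nat)" where
  "ends D (Arc x) = (case piece_at D x of
      Vertical d \<Rightarrow> directed d (lower_point D x 0) (upper_point D x 0)
    | Maximum Rightwards \<Rightarrow> (lower_point D x 0, lower_point D x 1)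
    | Maximum Leftwards \<Rightarrow> (lower_point D x 1, lower_point D x 0)
    | Minimum Rightwards \<Rightarrow> (upper_point D x 0, upper_point D x 1)
    | Minimum Leftwards \<Rightarrow> (upper_point D x 1, upper_point D x 0)
    | Crossing l d e \<Rightarrow> undefined)"
| "ends D (Line x m) = (case piece_at D x of
      Crossing l d e \<Rightarrow> (case m of
        SWNE \<Rightarrow> directed d (lower_point D x 0) (upper_point D x 1)
      | NWSE \<Rightarrow> directed e (lower_point D x 1) (upper_point D x 0))
    | _ \<Rightarrow> undefined)"

text \<open>
  A traversal runs once through all segments in the direction of orientation.  It necessarily
  starts at the base point, because no segment ends there, and for a compatible diagram it is
  unique.  Its existence means that the diagram has a single strand.
\<close>

definition is_traversal :: "diagram \<Rightarrow> segment list \<Rightarrow> bool" where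
  "is_traversal D ss \<longleftrightarrow> distinct ss \<and> set ss = segments D \<and>
     (\<forall>i. Suc i < length ss \<longrightarrow> snd (ends D (ss ! i)) = fst (ends D (ss ! Suc i)))"

definition Tang :: "diagram set" where
  "Tang = {D. compatible D \<and> (\<exists>ss. is_traversal D ss)}"

definition traversal :: "diagram \<Rightarrow> segment list" where
  "traversal D = (THE ss. is_traversal D ss)"


section \<open>Writhe\<close>

definition over_line :: "diagram \<Rightarrow> location \<Rightarrow> diagonal" where
  "over_line D x = (case piece_at D x of Crossing l d e \<Rightarrow> l | _ \<Rightarrow> undefined)"

definition under_line :: "diagram \<Rightarrow> location \<Rightarrow> diagonal" where
  "under_line D x = (case over_line D x of SWNE \<Rightarrow> NWSE | NWSE \<Rightarrow> SWNE)"

definition line_direction :: "diagram \<Rightarrow> location \<Rightarrow> diagonal \<Rightarrow> int \<times> int" where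
  "line_direction D x m = (case piece_at D x of
      Crossing l d e \<Rightarrow> (case m of
        SWNE \<Rightarrow> (case d of Up \<Rightarrow> (1, 1) | Down \<Rightarrow> (-1, -1))
      | NWSE \<Rightarrow> (case e of Up \<Rightarrow> (-1, 1) | Down \<Rightarrow> (1, -1)))
    | _ \<Rightarrow> undefined)"

definition to_the_right :: "int \<times> int \<Rightarrow> int \<times> int \<Rightarrow> bool" where
  "to_the_right u v \<longleftrightarrow> fst u * snd v - snd u * fst v < 0"  \<comment> \<open>\<open>v\<close> points to the right of \<open>u\<close>\<close>

definition crossing_sign :: "diagram \<Rightarrow> location \<Rightarrow> int" where
  "crossing_sign D x =
     (if to_the_right (line_direction D x (under_line D x)) (line_direction D x (over_line D x))
      then 1 else -1)"

definition writhe :: "diagram \<Rightarrow> int" where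
  "writhe D = (\<Sum>x\<in>crossings D. crossing_sign D x)"


section \<open>The invariant\<close>

definition crossing_lines :: "diagram \<Rightarrow> segment list" where
  "crossing_lines D = filter (\<lambda>s. \<exists>x m. s = Line x m) (traversal D)"

text \<open>Labels of crossing lines are counted from \<open>0\<close>, as are the letters of a word.\<close>

definition line_label :: "diagram \<Rightarrow> segment \<Rightarrow> nat" where
  "line_label D s = length (takeWhile (\<lambda>t. t \<noteq> s) (crossing_lines D))"

definition extrema_after :: "diagram \<Rightarrow> segment \<Rightarrow> piece \<Rightarrow> int" where
  "extrema_after D s q =
     int (length (filter (\<lambda>t. \<exists>x. t = Arc x \<and> piece_at D x = q)
       (dropWhile (\<lambda>t. t \<noteq> s) (traversal D))))"

text \<open>
  Types of extrema: \<open>(u\<^sub>-)\<close> is \<open>Maximum Rightwards\<close>, \<open>(u\<^sub>+)\<close> is \<open>Minimum Rightwards\<close>,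
  \<open>(d\<^sub>+)\<close> is \<open>Maximum Leftwards\<close> and \<open>(d\<^sub>-)\<close> is \<open>Minimum Leftwards\<close>.
\<close>

definition ud :: "diagram \<Rightarrow> segment \<Rightarrow> int" where
  "ud D s = extrema_after D s (Maximum Leftwards) - extrema_after D s (Minimum Leftwards)"

definition uu :: "diagram \<Rightarrow> segment \<Rightarrow> int" where
  "uu D s = extrema_after D s (Minimum Rightwards) - extrema_after D s (Maximum Rightwards)"

definition map_zpow :: "('c \<Rightarrow> 'c) \<Rightarrow> int \<Rightarrow> 'c \<Rightarrow> 'c" where
  "map_zpow T m = (if m \<ge> 0 then T ^^ nat m else (inv T) ^^ nat (- m))"

text \<open>\<open>w\<close> is a word \<open>[c\<^sub>(\<^sub>1\<^sub>), \<dots>, c\<^sub>(\<^sub>2\<^sub>n\<^sub>)]\<close>.\<close>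

definition bead ::
  "('c \<Rightarrow> 'c) \<Rightarrow> ('c \<Rightarrow> 'c) \<Rightarrow> diagram \<Rightarrow> 'c list \<Rightarrow> segment \<Rightarrow> int \<Rightarrow> int \<Rightarrow> 'c" where
  "bead Td Tu D w s p q =
     (map_zpow Td (ud D s + p) \<circ> map_zpow Tu (uu D s + q)) (w ! line_label D s)"

text \<open>
  Lines of directions \<open>Up\<close> on SW--NE and \<open>Down\<close> on NW--SE are both directed from left to right;
  in the case \<open>Down\<close>, \<open>Up\<close> both are directed from right to left.
\<close>

definition crossing_factor ::
  "('k::field, 'c::ab_group_add) coalg \<Rightarrow> ('c \<Rightarrow> 'c \<Rightarrow> 'k) \<Rightarrow> ('c \<Rightarrow> 'c) \<Rightarrow> ('c \<Rightarrow> 'c) \<Rightarrow>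
   diagram \<Rightarrow> 'c list \<Rightarrow> location \<Rightarrow> 'k" where
  "crossing_factor C b Td Tu D w x =
     (let over = bead Td Tu D w (Line x (over_line D x));
          under = bead Td Tu D w (Line x (under_line D x))
      in case piece_at D x of
          Crossing SWNE Up Up \<Rightarrow> b (over 0 0) (under 0 0)
        | Crossing SWNE Down Down \<Rightarrow> b (over 0 0) (under 0 0)
        | Crossing SWNE Up Down \<Rightarrow> conv_inv C b (over 0 1) (under 0 0)
        | Crossing SWNE Down Up \<Rightarrow> conv_inv C b (over 1 0) (under 0 0)
        | Crossing NWSE Up Up \<Rightarrow> conv_inv C b (over 0 0) (under 0 0)
        | Crossing NWSE Down Down \<Rightarrow> conv_inv C b (over 0 0) (under 0 0)
        | Crossing NWSE Up Down \<Rightarrow> b (over 0 0) (under 0 1)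
        | Crossing NWSE Down Up \<Rightarrow> b (over 0 0) (under 1 0)
        | _ \<Rightarrow> undefined)"

definition Inv ::
  "('k::field, 'c::ab_group_add) coalg \<Rightarrow> ('c \<Rightarrow> 'c \<Rightarrow> 'k) \<Rightarrow> ('c \<Rightarrow> 'c) \<Rightarrow> ('c \<Rightarrow> 'c) \<Rightarrow>
   diagram \<Rightarrow> 'c \<Rightarrow> 'k" where
  "Inv C b Td Tu D =
     (if crossings D = {} then counit C
      else (\<lambda>c. lin_ext (*) (\<lambda>w. \<Prod>x\<in>crossings D. crossing_factor C b Td Tu D w x)
                   (comult_iter C (2 * card (crossings D) - 1) c)))"

end

theory Submission
  imports Defs "HOL-Combinatorics.Permutations"
begin

text \<open>
  With cocommutativity, (qc.1) says that \<open>b(c, Tu d)\<close> is convolution inverse to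
  \<open>b\<^sup>-\<^sup>1(Td c, d)\<close>, whose inverse is \<open>b(Td c, d)\<close>.  So \<open>Td\<close> and \<open>Tu\<close> are adjoint, and by
  (qc.2) the value of \<open>b\<close> or \<open>b\<^sup>-\<^sup>1\<close> on \<open>Td\<^sup>p Tu\<^sup>q x\<close> and \<open>Td\<^sup>r Tu\<^sup>s y\<close> is its value on \<open>x\<close>
  and \<open>y\<close> when \<open>p - q = r - s\<close>.  The exponent difference of a bead counts maxima minus minima on
  the rest of the strand, which is determined by the vertical direction of the crossing line; the
  shifts in the crossing factors compensate exactly for opposite directions.  Thus every crossing
  contributes \<open>b\<close> or \<open>b\<^sup>-\<^sup>1\<close>, according to its sign, with no automorphisms left.  As the factors of
  the iterated coproduct may be permuted, the product over the crossings is a convolution power.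
\<close>

section \<open>Linear extension from words to the free vector space\<close>

lemma vector_space_mult: "vector_space ((*) :: 'k::field \<Rightarrow> 'k \<Rightarrow> 'k)"
  by unfold_locales (auto simp: algebra_simps)

context vector_space
begin

text \<open>Enlarging the range of summation only adds zero coefficients, so two elements can be
  summed over one common finite set.\<close>

lemma lin_ext_superset:
  assumes "finite A" "Poly_Mapping.keys s \<subseteq> A"
  shows "lin_ext scale f s = (\<Sum>w\<in>A. Poly_Mapping.lookup s w *s f w)"
  unfolding lin_ext_def
  by (rule sum.mono_neutral_left) (use assms in \<open>auto simp: in_keys_iff\<close>)

lemma linear_lin_ext: "Vector_Spaces.linear ft_scale scale (lin_ext scale f)"
proof -
  have "lin_ext scale f (s + t) = lin_ext scale f s + lin_ext scale f t" for s t
  proof -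
    let ?A = "Poly_Mapping.keys s \<union> Poly_Mapping.keys t"
    have "lin_ext scale f (s + t) = (\<Sum>w\<in>?A. Poly_Mapping.lookup (s + t) w *s f w)"
      by (rule lin_ext_superset) (use Poly_Mapping.keys_add[of s t] in auto)
    then show ?thesis
      by (simp add: lin_ext_superset[of ?A] lookup_add scale_left_distrib sum.distrib)
  qed
  moreover have "lin_ext scale f (ft_scale r s) = r *s lin_ext scale f s" for r s
  proof -
    have "lin_ext scale f (ft_scale r s)
        = (\<Sum>w\<in>Poly_Mapping.keys s. Poly_Mapping.lookup (ft_scale r s) w *s f w)"
      by (rule lin_ext_superset) (auto simp: in_keys_iff)
    then show ?thesis
      by (simp add: lin_ext_def scale_sum_right)
  qed
  ultimately show ?thesis
    unfolding Vector_Spaces.linear_iff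
    using ft.vector_space_axioms vector_space_axioms by auto
qed

lemma lin_ext_single [simp]: "lin_ext scale f (Poly_Mapping.single w r) = r *s f w"
  by (simp add: lin_ext_def)

lemma lin_ext_lin_ext:
  "lin_ext scale f (lin_ext ft_scale g s) = lin_ext scale (\<lambda>w. lin_ext scale f (g w)) s"
proof -
  interpret L: Vector_Spaces.linear ft_scale scale "lin_ext scale f"
    by (rule linear_lin_ext)
  show ?thesis
    unfolding lin_ext_def[of ft_scale] by (simp add: L.sum L.scale lin_ext_def[of scale "\<lambda>w. lin_ext scale f (g w)"])
qed

end

lemma lin_ext_cong:
  "(\<And>w. w \<in> Poly_Mapping.keys s \<Longrightarrow> f w = g w) \<Longrightarrow> lin_ext scale f s = lin_ext scale g s"
  by (simp add: lin_ext_def)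

lemmas lin_ext_mult_lin_ext = vector_space.lin_ext_lin_ext[OF vector_space_mult]
  and lin_ext_mult_single [simp] = vector_space.lin_ext_single[OF vector_space_mult]
  and linear_lin_ext_mult = vector_space.linear_lin_ext[OF vector_space_mult]

section \<open>Multilinear functions of words\<close>

abbreviation functional :: "('k::field, 'c::ab_group_add) coalg \<Rightarrow> ('c \<Rightarrow> 'k) \<Rightarrow> bool" where
  "functional C \<equiv> Vector_Spaces.linear (smult C) (*)"

text \<open>Only words of length \<open>m\<close> are tested, since functions on words are total and
  their values on other words are arbitrary.\<close>

definition multilinear ::
  "('k::field, 'c::ab_group_add) coalg \<Rightarrow> nat \<Rightarrow> ('c list \<Rightarrow> 'k) \<Rightarrow> bool" where
  "multilinear C m f \<longleftrightarrow> (\<forall>w i. length w = m \<longrightarrow> i < m \<longrightarrow> functional C (\<lambda>x. f (w[i := x])))"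

context coalgebra
begin

lemma functional_iff:
  "functional C g \<longleftrightarrow> (\<forall>x y. g (x + y) = g x + g y) \<and> (\<forall>r x. g (smult C r x) = r * g x)"
  using vector_space_axioms vector_space_mult by (auto simp: Vector_Spaces.linear_iff)

lemma functional_mult_left: "functional C g \<Longrightarrow> functional C (\<lambda>x. r * g x)"
  by (auto simp: functional_iff algebra_simps)

lemma functional_mult_right: "functional C g \<Longrightarrow> functional C (\<lambda>x. g x * r)"
  by (auto simp: functional_iff algebra_simps)

lemma bilinear_form_iff:
  "bilinear_form C f \<longleftrightarrow>
     (\<forall>d. functional C (\<lambda>c. f c d)) \<and> (\<forall>c. functional C (\<lambda>d. f c d))"
  by (simp add: bilinear_form_def)

text \<open>Each generating relation involves words of a single length, so a multilinear
  \<open>f\<close> kills it once \<open>f\<close> is cut off to 0 on all other lengths. The cut-off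
  matters because the span contains relations of every length.\<close>

lemma tensor_eq_lin_ext:
  assumes f: "multilinear C m f" and st: "tensor_eq (smult C) s t"
  shows "lin_ext (*) (\<lambda>w. if length w = m then f w else 0) s =
         lin_ext (*) (\<lambda>w. if length w = m then f w else 0) t"
proof -
  let ?f = "\<lambda>w. if length w = m then f w else 0"
  interpret L: Vector_Spaces.linear ft_scale "(*)" "lin_ext (*) ?f"
    by (rule linear_lin_ext_mult)
  have lin: "functional C (\<lambda>x. ?f (xs @ [x] @ ys))" for xs ys
  proof (cases "length xs + Suc (length ys) = m")
    case True
    then show ?thesis
      using f[unfolded multilinear_def, rule_format, of "xs @ [0] @ ys" "length xs"] by simp
  qed (auto simp: functional_iff)
  have "lin_ext (*) ?f u = 0" if "u \<in> tensor_relations (smult C)" for u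
    using that unfolding tensor_relations_def
  proof (elim UnE CollectE exE conjE)
    fix xs ys x y
    assume u: "u = pure (xs @ [x + y] @ ys) - pure (xs @ [x] @ ys) - pure (xs @ [y] @ ys)"
    have "?f (xs @ [x + y] @ ys) = ?f (xs @ [x] @ ys) + ?f (xs @ [y] @ ys)"
      using lin[of xs ys] unfolding functional_iff by blast
    then show ?thesis by (simp only: u L.diff lin_ext_mult_single) simp
  next
    fix xs ys r x
    assume u: "u = pure (xs @ [smult C r x] @ ys) - ft_scale r (pure (xs @ [x] @ ys))"
    have "?f (xs @ [smult C r x] @ ys) = r * ?f (xs @ [x] @ ys)"
      using lin[of xs ys] unfolding functional_iff by blast
    then show ?thesis by (simp only: u L.diff L.scale lin_ext_mult_single) simp
  qed
  then have "lin_ext (*) ?f (s - t) = 0"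
    using st L.eq_0_on_span unfolding tensor_eq_def by blast
  then show ?thesis by (simp add: L.diff)
qed

section \<open>Sweedler sums\<close>

lemma sweedler_add: "sweedler C c (\<lambda>x y. f x y + g x y) = sweedler C c f + sweedler C c g"
  by (simp add: sweedler_def lin_ext_def distrib_left sum.distrib)

lemma sweedler_mult_left: "sweedler C c (\<lambda>x y. r * f x y) = r * sweedler C c f"
  by (simp add: sweedler_def lin_ext_def sum_distrib_left mult.left_commute)

lemma sweedler_mult_right: "sweedler C c (\<lambda>x y. f x y * r) = sweedler C c f * r"
  by (simp add: sweedler_def lin_ext_def sum_distrib_right mult.assoc)

lemma sweedler_commute:
  "sweedler C c (\<lambda>x y. sweedler C d (f x y)) = sweedler C d (\<lambda>u v. sweedler C c (\<lambda>x y. f x y u v))"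
  unfolding sweedler_def lin_ext_def sum_distrib_left
  by (subst sum.swap) (simp add: mult.left_commute)

lemma functional_sweedler_param:
  "(\<And>x y. functional C (\<lambda>z. f z x y)) \<Longrightarrow> functional C (\<lambda>z. sweedler C c (f z))"
  unfolding functional_iff
  by (auto simp flip: sweedler_add sweedler_mult_left intro!: arg_cong[of _ _ "sweedler C c"] ext)

lemma multilinear_two:
  assumes "bilinear_form C f"
  shows "multilinear C 2 (\<lambda>w. f (w ! 0) (w ! 1))"
  using assms unfolding multilinear_def bilinear_form_iff
  by (auto simp: less_2_cases_iff)

lemma comult_keysE:
  assumes "w \<in> Poly_Mapping.keys (comult C c)"
  obtains x y where "w = [x, y]"
  using comult_degree[OF assms] by (auto simp: numeral_2_eq_2 length_Suc_conv)

text \<open>The coproduct lives in degree two, so the cut-off of \<open>tensor_eq_lin_ext\<close>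
  leaves the sum unchanged.\<close>

lemma sweedler_eq_restricted:
  "sweedler C c f = lin_ext (*) (\<lambda>w. if length w = 2 then f (w ! 0) (w ! 1) else 0) (comult C c)"
  unfolding sweedler_def by (rule lin_ext_cong) (auto dest: comult_degree)

text \<open>\<open>comult C\<close> is linear only up to \<open>tensor_eq\<close>; a bilinear
  \<open>f\<close> does not see the difference.\<close>

lemma functional_sweedler:
  assumes "bilinear_form C f"
  shows "functional C (\<lambda>c. sweedler C c f)"
proof -
  let ?f = "\<lambda>w. if length w = 2 then f (w ! 0) (w ! 1) else 0"
  interpret L: Vector_Spaces.linear ft_scale "(*)" "lin_ext (*) ?f"
    by (rule linear_lin_ext_mult)
  note eq = tensor_eq_lin_ext[OF multilinear_two[OF assms]]
  show ?thesis
    unfolding functional_iff sweedler_eq_restricted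
    by (simp add: eq[OF comult_add] eq[OF comult_scale] L.add L.scale)
qed

lemma sweedler_cocommutative:
  assumes "cocommutative C" "bilinear_form C f"
  shows "sweedler C c f = sweedler C c (\<lambda>x y. f y x)"
proof -
  have "sweedler C c f = lin_ext (*) (\<lambda>w. if length w = 2 then f (w ! 0) (w ! 1) else 0)
      (lin_ext ft_scale (\<lambda>w. pure [w ! 1, w ! 0]) (comult C c))"
    unfolding sweedler_eq_restricted
    using assms(1) by (intro tensor_eq_lin_ext[OF multilinear_two[OF assms(2)]])
      (simp add: cocommutative_def)
  also have "\<dots> = sweedler C c (\<lambda>x y. f y x)"
    by (simp add: lin_ext_mult_lin_ext sweedler_def)
  finally show ?thesis .
qed

lemma sweedler_counit_left:
  assumes "functional C g"
  shows "sweedler C c (\<lambda>x y. counit C x * g y) = g c"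
proof -
  interpret g: Vector_Spaces.linear "smult C" "(*)" g by fact
  have "g c = g (lin_ext (smult C) (\<lambda>w. smult C (counit C (w ! 0)) (w ! 1)) (comult C c))"
    by (simp only: counit_left)
  also have "\<dots> = sweedler C c (\<lambda>x y. counit C x * g y)"
    by (simp add: lin_ext_def sweedler_def g.sum g.scale)
  finally show ?thesis ..
qed

lemma sweedler_counit_right:
  assumes "functional C g"
  shows "sweedler C c (\<lambda>x y. g x * counit C y) = g c"
proof -
  interpret g: Vector_Spaces.linear "smult C" "(*)" g by fact
  have "g c = g (lin_ext (smult C) (\<lambda>w. smult C (counit C (w ! 1)) (w ! 0)) (comult C c))"
    by (simp only: counit_right)
  also have "\<dots> = sweedler C c (\<lambda>x y. g x * counit C y)"
    by (simp add: lin_ext_def sweedler_def g.sum g.scale mult.commute[of "g _"])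
  finally show ?thesis ..
qed

text \<open>The axiom \<open>coassoc\<close> is a congruence of representatives; a trilinear
  \<open>f\<close> turns it into an equality of scalars.\<close>

lemma sweedler_coassoc:
  assumes "\<And>y z. functional C (\<lambda>x. f x y z)" "\<And>x z. functional C (\<lambda>y. f x y z)"
    "\<And>x y. functional C (\<lambda>z. f x y z)"
  shows "sweedler C c (\<lambda>u z. sweedler C u (\<lambda>x y. f x y z)) =
         sweedler C c (\<lambda>x v. sweedler C v (\<lambda>y z. f x y z))"
proof -
  let ?f = "\<lambda>w. f (w ! 0) (w ! 1) (w ! 2)"
  let ?g = "\<lambda>w. if length w = 3 then ?f w else 0"
  have *: "i < 3 \<longleftrightarrow> i = 0 \<or> i = 1 \<or> i = 2" for i :: nat by auto
  have m: "multilinear C 3 ?f"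
    unfolding multilinear_def by (auto simp: * assms)
  have "sweedler C c (\<lambda>u z. sweedler C u (\<lambda>x y. f x y z)) =
      lin_ext (*) ?g (comult_at C 0 (comult C c))"
    unfolding comult_at_def lin_ext_mult_lin_ext sweedler_def
    by (intro lin_ext_cong) (auto elim!: comult_keysE)
  also have "\<dots> = lin_ext (*) ?g (comult_at C 1 (comult C c))"
    by (rule tensor_eq_lin_ext[OF m coassoc])
  also have "\<dots> = sweedler C c (\<lambda>x v. sweedler C v (\<lambda>y z. f x y z))"
    unfolding comult_at_def lin_ext_mult_lin_ext sweedler_def
    by (intro lin_ext_cong) (auto elim!: comult_keysE)
  finally show ?thesis .
qed

section \<open>Iterated Sweedler sums\<close>

text \<open>The index counts coproducts, so the words summed over have \<open>m + 1\<close>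
  letters.\<close>

definition iter_sweedler :: "nat \<Rightarrow> 'c \<Rightarrow> ('c list \<Rightarrow> 'k) \<Rightarrow> 'k" where
  "iter_sweedler m c f = lin_ext (*) f (comult_iter C m c)"

lemma iter_sweedler_0 [simp]: "iter_sweedler 0 c f = f [c]"
  by (simp add: iter_sweedler_def)

lemma iter_sweedler_Suc:
  "iter_sweedler (Suc m) c f =
     iter_sweedler m c (\<lambda>w. sweedler C (w ! 0) (\<lambda>x y. f (x # y # drop 1 w)))"
  unfolding iter_sweedler_def comult_iter.simps comult_at_def lin_ext_mult_lin_ext sweedler_def
  by (intro lin_ext_cong) (auto elim!: comult_keysE)

lemma iter_sweedler_cong:
  "(\<And>w. length w = Suc m \<Longrightarrow> f w = g w) \<Longrightarrow> iter_sweedler m c f = iter_sweedler m c g"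
proof (induction m arbitrary: f g)
  case (Suc m)
  show ?case
    unfolding iter_sweedler_Suc by (rule Suc.IH) (simp add: Suc.prems)
qed simp

text \<open>\<open>comult_iter\<close> always splits the first letter, so the right factor
  \<open>y\<close> of the very first coproduct stays the last letter and all further splitting
  happens inside \<open>x\<close>. This permits inductions that peel letters off from the
  right.\<close>

lemma iter_sweedler_snoc:
  "iter_sweedler (Suc m) c f = sweedler C c (\<lambda>x y. iter_sweedler m x (\<lambda>w. f (w @ [y])))"
proof (induction m arbitrary: f)
  case 0
  show ?case by (simp add: iter_sweedler_Suc)
next
  case (Suc m)
  have "iter_sweedler (Suc (Suc m)) c f = sweedler C c (\<lambda>x y. iter_sweedler m x
      (\<lambda>w. sweedler C ((w @ [y]) ! 0) (\<lambda>u v. f (u # v # drop 1 (w @ [y])))))"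
    by (subst iter_sweedler_Suc) (rule Suc.IH)
  also have "\<dots> = sweedler C c (\<lambda>x y. iter_sweedler m x
      (\<lambda>w. sweedler C (w ! 0) (\<lambda>u v. f ((u # v # drop 1 w) @ [y]))))"
    by (intro arg_cong[of _ _ "sweedler C c"] ext iter_sweedler_cong) (simp add: nth_append)
  finally show ?case by (simp only: iter_sweedler_Suc)
qed

lemma iter_sweedler_add:
  "iter_sweedler m c (\<lambda>w. f w + g w) = iter_sweedler m c f + iter_sweedler m c g"
  by (simp add: iter_sweedler_def lin_ext_def distrib_left sum.distrib)

lemma iter_sweedler_mult_left: "iter_sweedler m c (\<lambda>w. r * f w) = r * iter_sweedler m c f"
  by (simp add: iter_sweedler_def lin_ext_def sum_distrib_left mult.left_commute)

lemma iter_sweedler_mult_right: "iter_sweedler m c (\<lambda>w. f w * r) = iter_sweedler m c f * r"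
  by (simp add: iter_sweedler_def lin_ext_def sum_distrib_right mult.assoc)

lemma functional_iter_sweedler_param:
  assumes "\<And>w. length w = Suc m \<Longrightarrow> functional C (\<lambda>z. f z w)"
  shows "functional C (\<lambda>z. iter_sweedler m c (f z))"
  unfolding functional_iff
proof (intro conjI allI)
  fix x y show "iter_sweedler m c (f (x + y)) = iter_sweedler m c (f x) + iter_sweedler m c (f y)"
    unfolding iter_sweedler_add[symmetric]
    by (rule iter_sweedler_cong) (use assms in \<open>simp add: functional_iff\<close>)
next
  fix r x show "iter_sweedler m c (f (smult C r x)) = r * iter_sweedler m c (f x)"
    unfolding iter_sweedler_mult_left[symmetric]
    by (rule iter_sweedler_cong) (use assms in \<open>simp add: functional_iff\<close>)
qed

lemma multilinear_append:
  assumes "multilinear C (m + length v) f"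
  shows "multilinear C m (\<lambda>w. f (w @ v))"
  unfolding multilinear_def
proof (intro allI impI)
  fix w :: "'c list" and i assume "length w = m" "i < m"
  then show "functional C (\<lambda>x. f (w[i := x] @ v))"
    using assms[unfolded multilinear_def, rule_format, of "w @ v" i]
    by (simp add: list_update_append1)
qed

lemma multilinear_nth:
  assumes "multilinear C (length u + Suc (length v)) f"
  shows "functional C (\<lambda>x. f (u @ x # v))"
  using assms[unfolded multilinear_def, rule_format, of "u @ 0 # v" "length u"] by simp

text \<open>By \<open>iter_sweedler_snoc\<close> the sum is a Sweedler sum of a form in
  \<open>x\<close> and the last letter \<open>y\<close>, which is bilinear by induction.\<close>

lemma functional_iter_sweedler:
  "multilinear C (Suc m) f \<Longrightarrow> functional C (\<lambda>c. iter_sweedler m c f)"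
proof (induction m arbitrary: f)
  case 0
  from multilinear_nth[of "[]" "[]" f] 0 show ?case by simp
next
  case (Suc m)
  have "multilinear C (Suc m) (\<lambda>w. f (w @ [y]))" for y
    by (rule multilinear_append) (use Suc.prems in simp)
  with Suc.IH have 1: "functional C (\<lambda>c. iter_sweedler m c (\<lambda>w. f (w @ [y])))" for y
    by blast
  have 2: "functional C (\<lambda>y. iter_sweedler m c (\<lambda>w. f (w @ [y])))" for c
    by (rule functional_iter_sweedler_param, rule multilinear_nth) (use Suc.prems in simp)
  show ?case
    unfolding iter_sweedler_snoc
    by (rule functional_sweedler) (simp add: bilinear_form_iff 1 2)
qed

lemma multilinear_permute:
  assumes f: "multilinear C m f" and p: "p permutes {..<m}"
  shows "multilinear C m (\<lambda>w. f (permute_list p w))"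
  unfolding multilinear_def
proof (intro allI impI)
  fix w :: "'c list" and i assume w: "length w = m" "i < m"
  \<comment> \<open>\<open>permute_list p w\<close> has at place \<open>l\<close> the letter of
    \<open>w\<close> at place \<open>p l\<close>, so letter \<open>i\<close> of \<open>w\<close>
    appears at the place given by the inverse of \<open>p\<close>.\<close>
  let ?j = "Hilbert_Choice.inv p i"
  have j: "?j < m"
    using permutes_in_image[OF permutes_inv[OF p], of i] w by simp
  have "permute_list p (w[i := x]) = (permute_list p w)[?j := x]" for x
  proof (rule nth_equalityI)
    fix l assume "l < length (permute_list p (w[i := x]))"
    then have l: "l < m" using w by simp
    have "p l = i \<longleftrightarrow> l = ?j" using permutes_inverses[OF p] by metis
    moreover have "p l < m" using permutes_in_image[OF p, of l] l by simp
    ultimately show "permute_list p (w[i := x]) ! l = (permute_list p w)[?j := x] ! l"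
      using l w p by (auto simp: permute_list_nth nth_list_update)
  qed simp
  then show "functional C (\<lambda>x. f (permute_list p (w[i := x])))"
    using f j w by (simp add: multilinear_def)
qed

text \<open>Induction peels off the last letter. A swap that avoids it happens inside the shorter
  word; a swap of the last two letters is moved by coassociativity into one coproduct, where
  cocommutativity applies.\<close>

lemma iter_sweedler_swap_adjacent:
  assumes cocomm: "cocommutative C"
  shows "multilinear C (Suc m) f \<Longrightarrow> p < m \<Longrightarrow>
    iter_sweedler m c (\<lambda>w. f (permute_list (transpose p (Suc p)) w)) = iter_sweedler m c f"
proof (induction m arbitrary: f c)
  case (Suc m)
  show ?case
  proof (cases "p = m")
    case False
    then have p: "p < m" using Suc.prems by simp
    have mult: "multilinear C (Suc m) (\<lambda>w. f (w @ [y]))" for y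
      by (rule multilinear_append) (use Suc.prems in simp)
    have "iter_sweedler m x (\<lambda>w. f (permute_list (transpose p (Suc p)) (w @ [y]))) =
        iter_sweedler m x (\<lambda>w. f (permute_list (transpose p (Suc p)) w @ [y]))" for x y
    proof (rule iter_sweedler_cong)
      fix w :: "'c list" assume "length w = Suc m"
      with p have "permute_list (transpose p (Suc p)) (w @ [y]) =
          permute_list (transpose p (Suc p)) w @ [y]"
        by (intro nth_equalityI)
          (auto simp: permute_list_def nth_append transpose_def simp del: upt_Suc)
      then show "f (permute_list (transpose p (Suc p)) (w @ [y])) =
          f (permute_list (transpose p (Suc p)) w @ [y])" by simp
    qed
    then show ?thesis
      unfolding iter_sweedler_snoc using Suc.IH[OF mult p] by simp
  next
    case p: True
    show ?thesis
    proof (cases m)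
      case 0
      have f: "bilinear_form C (\<lambda>x y. f [x, y])"
        using multilinear_nth[of "[]" "[_]" f] multilinear_nth[of "[_]" "[]" f] Suc.prems 0
        by (simp add: bilinear_form_iff)
      show ?thesis
        using sweedler_cocommutative[OF cocomm f]
        by (simp add: p 0 iter_sweedler_snoc permute_list_def)
    next
      case (Suc n)
      \<comment> \<open>All letters before the last two are summed up inside \<open>g\<close>, which
        leaves a trilinear function for \<open>sweedler_coassoc\<close>.\<close>
      define g where "g u v y = iter_sweedler n u (\<lambda>w. f (w @ [v, y]))" for u v y
      have mult: "multilinear C (Suc (Suc (Suc n))) f" using Suc.prems Suc by simp
      have 1: "functional C (\<lambda>u. g u v y)" for v y
        unfolding g_def
        by (rule functional_iter_sweedler, rule multilinear_append) (use mult in simp)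
      have 2: "functional C (\<lambda>v. g u v y)" for u y
        unfolding g_def
        by (rule functional_iter_sweedler_param, rule multilinear_nth) (use mult in simp)
      have 3: "functional C (\<lambda>y. g u v y)" for u v
        unfolding g_def
        by (rule functional_iter_sweedler_param)
          (use mult multilinear_nth[of "_ @ [v]" "[]" f] in simp)
      have swap: "g' u v y = g u y v"
        if "g' = (\<lambda>u v y. iter_sweedler n u
          (\<lambda>w. f (permute_list (transpose p (Suc p)) (w @ [v, y]))))" for u v y g'
        unfolding that g_def
      proof (rule iter_sweedler_cong)
        fix w :: "'c list" assume "length w = Suc n"
        then have "permute_list (transpose p (Suc p)) (w @ [v, y]) = w @ [y, v]"
          by (intro nth_equalityI)
            (auto simp: permute_list_def nth_append p Suc transpose_def nth_Cons'
              simp del: upt_Suc)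
        then show "f (permute_list (transpose p (Suc p)) (w @ [v, y])) = f (w @ [y, v])"
          by simp
      qed
      have "iter_sweedler (Suc m) c (\<lambda>w. f (permute_list (transpose p (Suc p)) w)) =
          sweedler C c (\<lambda>x y. sweedler C x (\<lambda>u v. g u y v))"
        by (simp add: Suc iter_sweedler_snoc swap[OF refl, simplified])
      also have "\<dots> = sweedler C c (\<lambda>u z. sweedler C z (\<lambda>v y. g u y v))"
        by (rule sweedler_coassoc) (fact 1 2 3)+
      also have "\<dots> = sweedler C c (\<lambda>u z. sweedler C z (\<lambda>v y. g u v y))"
        by (subst sweedler_cocommutative[OF cocomm]) (auto simp: bilinear_form_iff 2 3)
      also have "\<dots> = sweedler C c (\<lambda>x y. sweedler C x (\<lambda>u v. g u v y))"
        by (rule sweedler_coassoc[symmetric]) (fact 1 2 3)+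
      also have "\<dots> = iter_sweedler (Suc m) c f"
        by (simp add: g_def Suc iter_sweedler_snoc)
      finally show ?thesis .
    qed
  qed
qed simp

text \<open>Adjacent swaps generate all permutations: conjugation widens a swap by one place, and
  every permutation is a composite of transpositions.\<close>

lemma iter_sweedler_permute:
  assumes cocomm: "cocommutative C" and f: "multilinear C (Suc m) f" and p: "p permutes {..m}"
  shows "iter_sweedler m c (\<lambda>w. f (permute_list p w)) = iter_sweedler m c f"
proof -
  \<comment> \<open>All multilinear \<open>f\<close> are quantified at once: for a composite, the
    property of one factor is applied to \<open>f\<close> permuted by the other.\<close>
  define Q where "Q p \<longleftrightarrow> p permutes {..<Suc m} \<and> (\<forall>f. multilinear C (Suc m) f \<longrightarrow>
    iter_sweedler m c (\<lambda>w. f (permute_list p w)) = iter_sweedler m c f)" for p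
  have comp: "Q (p \<circ> q)" if "Q p" "Q q" for p q
    unfolding Q_def
  proof (intro conjI allI impI)
    show "p \<circ> q permutes {..<Suc m}"
      using that unfolding Q_def by (blast intro: permutes_compose)
    fix f assume f: "multilinear C (Suc m) f"
    have "iter_sweedler m c (\<lambda>w. f (permute_list (p \<circ> q) w)) =
        iter_sweedler m c (\<lambda>w. f (permute_list q (permute_list p w)))"
      using that unfolding Q_def by (intro iter_sweedler_cong) (simp add: permute_list_compose)
    also have "\<dots> = iter_sweedler m c (\<lambda>w. f (permute_list q w))"
      using that(1) multilinear_permute[OF f, of q] that(2)
      unfolding Q_def by (elim conjE allE[of _ "\<lambda>w. f (permute_list q w)"]) simp
    also have "\<dots> = iter_sweedler m c f"
      using that(2) f unfolding Q_def by blast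
    finally show "iter_sweedler m c (\<lambda>w. f (permute_list (p \<circ> q) w)) = iter_sweedler m c f" .
  qed
  have adj: "Q (transpose a (Suc a))" if "a < m" for a
    unfolding Q_def using that iter_sweedler_swap_adjacent[OF cocomm]
    by (auto intro: permutes_swap_id)
  have tr: "Q (transpose a (Suc (a + k)))" if "a + k < m" for a k
    using that
  proof (induction k)
    case (Suc k)
    let ?b = "Suc (a + k)"
    have "Q (transpose ?b (Suc ?b) \<circ> (transpose a ?b \<circ> transpose ?b (Suc ?b)))"
      using Suc by (intro comp adj) auto
    moreover have "transpose ?b (Suc ?b) \<circ> (transpose a ?b \<circ> transpose ?b (Suc ?b)) =
        transpose a (Suc (a + Suc k))"
      by (auto simp: fun_eq_iff transpose_def)
    ultimately show ?case by simp
  qed (use adj in simp)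
  have tr': "Q (transpose a b)" if "a \<le> m" "b \<le> m" "a \<noteq> b" for a b
  proof (cases "a < b")
    case True
    with tr[of a "b - Suc a"] that show ?thesis by simp
  next
    case False
    with tr[of b "a - Suc b"] that show ?thesis by (simp add: transpose_commute)
  qed
  have "Q p"
    using p finite_atMost
  proof (induction rule: permutes_induct)
    case id
    show ?case by (simp add: Q_def permutes_id[unfolded id_def])
  next
    case (swap a b p)
    then show ?case by (intro comp tr') auto
  qed
  then show ?thesis using f unfolding Q_def by blast
qed

section \<open>Convolution\<close>

lemma bilinear_form_left: "bilinear_form C f \<Longrightarrow> functional C (\<lambda>c. f c d)"
  by (simp add: bilinear_form_iff)

lemma bilinear_form_right: "bilinear_form C f \<Longrightarrow> functional C (f c)"
  by (simp add: bilinear_form_iff)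

lemmas bilinear_form_functional = bilinear_form_left bilinear_form_right

lemmas functional_intros = functional_mult_left functional_mult_right functional_sweedler_param

lemma bilinear_formI:
  "(\<And>d. functional C (\<lambda>c. f c d)) \<Longrightarrow> (\<And>c. functional C (\<lambda>d. f c d)) \<Longrightarrow> bilinear_form C f"
  by (simp add: bilinear_form_iff)

lemma bilinear_form_conv:
  assumes "bilinear_form C f" "bilinear_form C g"
  shows "bilinear_form C (conv C f g)"
proof (rule bilinear_formI)
  show "functional C (\<lambda>c. conv C f g c d)" for d
    unfolding conv_def
    by (rule functional_sweedler) (intro bilinear_formI functional_intros assms[THEN bilinear_form_left]
      assms[THEN bilinear_form_right])
  show "functional C (\<lambda>d. conv C f g c d)" for c
    unfolding conv_def sweedler_commute[of c]
    by (rule functional_sweedler) (intro bilinear_formI functional_intros assms[THEN bilinear_form_left]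
      assms[THEN bilinear_form_right])
qed

lemma bilinear_form_conv_one: "bilinear_form C (conv_one C)"
  unfolding conv_one_def by (intro bilinear_formI functional_intros counit_linear)

lemma conv_one_left:
  assumes "bilinear_form C f"
  shows "conv C (conv_one C) f = f"
proof (intro ext)
  fix c d
  have "conv C (conv_one C) f c d =
      sweedler C c (\<lambda>x y. counit C x * sweedler C d (\<lambda>u v. counit C u * f y v))"
    by (simp add: conv_def conv_one_def mult.assoc sweedler_mult_left)
  also have "\<dots> = f c d"
    using assms by (simp add: sweedler_counit_left bilinear_form_functional)
  finally show "conv C (conv_one C) f c d = f c d" .
qed

lemma conv_one_right:
  assumes "bilinear_form C f"
  shows "conv C f (conv_one C) = f"
proof (intro ext)
  fix c d
  have "conv C f (conv_one C) c d =
      sweedler C c (\<lambda>x y. sweedler C d (\<lambda>u v. f x u * counit C v) * counit C y)"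
    by (simp add: conv_def conv_one_def mult_ac flip: sweedler_mult_left sweedler_mult_right)
  also have "\<dots> = f c d"
    using assms by (simp add: sweedler_counit_right bilinear_form_functional
        functional_sweedler_param functional_mult_right)
  finally show "conv C f (conv_one C) c d = f c d" .
qed

text \<open>Coassociativity is used once in each argument on the summand \<open>?t\<close>, with
  interchanges of the sums over \<open>c\<close> and \<open>d\<close> around it.\<close>

lemma conv_assoc:
  assumes f: "bilinear_form C f" and g: "bilinear_form C g" and h: "bilinear_form C h"
  shows "conv C (conv C f g) h = conv C f (conv C g h)"
proof (intro ext)
  fix c d
  note fgh = bilinear_form_functional[OF f] bilinear_form_functional[OF g]
    bilinear_form_functional[OF h]
  let ?t = "\<lambda>c1 c2 c3 d1 d2 d3. f c1 d1 * g c2 d2 * h c3 d3"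
  have coassoc_d: "sweedler C d (\<lambda>x d3. sweedler C x (\<lambda>d1 d2. ?t c1 c2 c3 d1 d2 d3)) =
      sweedler C d (\<lambda>d1 y. sweedler C y (\<lambda>d2 d3. ?t c1 c2 c3 d1 d2 d3))" for c1 c2 c3
    by (rule sweedler_coassoc; intro functional_intros fgh)
  have "conv C (conv C f g) h c d = sweedler C c (\<lambda>x c3. sweedler C d (\<lambda>u d3.
      sweedler C x (\<lambda>c1 c2. sweedler C u (\<lambda>d1 d2. ?t c1 c2 c3 d1 d2 d3))))"
    by (simp add: conv_def sweedler_mult_right)
  also have "\<dots> = sweedler C c (\<lambda>x c3. sweedler C x (\<lambda>c1 c2. sweedler C d (\<lambda>u d3.
      sweedler C u (\<lambda>d1 d2. ?t c1 c2 c3 d1 d2 d3))))"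
    by (subst sweedler_commute) simp
  also have "\<dots> = sweedler C c (\<lambda>c1 y. sweedler C y (\<lambda>c2 c3. sweedler C d (\<lambda>d1 v.
      sweedler C v (\<lambda>d2 d3. ?t c1 c2 c3 d1 d2 d3))))"
    unfolding coassoc_d by (rule sweedler_coassoc; intro functional_intros fgh)
  also have "\<dots> = sweedler C c (\<lambda>c1 y. sweedler C d (\<lambda>d1 v. sweedler C y (\<lambda>c2 c3.
      sweedler C v (\<lambda>d2 d3. ?t c1 c2 c3 d1 d2 d3))))"
    by (subst (2) sweedler_commute) simp
  also have "\<dots> = conv C f (conv C g h) c d"
    by (simp add: conv_def sweedler_mult_left mult.assoc)
  finally show "conv C (conv C f g) h c d = conv C f (conv C g h) c d" .
qed

text \<open>The monoid argument l = l(fr) = (lf)r = r. Identities between forms are obtained from it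
  below by exhibiting both sides as inverses of a third form.\<close>

lemma conv_inverse_unique:
  assumes "bilinear_form C f" "bilinear_form C l" "bilinear_form C r"
    and "conv C l f = conv_one C" "conv C f r = conv_one C"
  shows "l = r"
  using conv_assoc[of l f r] assms by (simp add: conv_one_left conv_one_right)

text \<open>Uniqueness of inverses makes the definite description in \<open>conv_inv\<close> denote
  an actual inverse.\<close>

lemma is_conv_inverse_conv_inv:
  assumes "bilinear_form C b" "conv_invertible C b"
  shows "is_conv_inverse C b (conv_inv C b)"
proof -
  obtain b' where b': "is_conv_inverse C b b'"
    using assms(2) unfolding conv_invertible_def by blast
  have "b'' = b'" if "is_conv_inverse C b b''" for b''
    using conv_inverse_unique[of b b'' b'] assms(1) b' that unfolding is_conv_inverse_def by blast
  with b' show ?thesis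
    unfolding conv_inv_def by (rule theI)
qed

lemma bilinear_form_conv_npow: "bilinear_form C f \<Longrightarrow> bilinear_form C (conv_npow C f n)"
  by (induction n) (simp_all add: bilinear_form_conv_one bilinear_form_conv)

lemma conv_conv_inverse:
  assumes "bilinear_form C f" "bilinear_form C g" "conv C f g = conv_one C" "bilinear_form C h"
  shows "conv C f (conv C g h) = h"
  using assms by (simp flip: conv_assoc add: conv_one_left)

text \<open>Cocommutativity permutes the factors of \<open>f(c\<^sub>2, c\<^sub>4) g(c\<^sub>1, c\<^sub>3)\<close> to \<open>f(c\<^sub>1, c\<^sub>2) g(c\<^sub>3, c\<^sub>4)\<close>.\<close>

lemma sweedler_conv:
  assumes cocomm: "cocommutative C" and f: "bilinear_form C f" and g: "bilinear_form C g"
  shows "sweedler C c (conv C g f) =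
    sweedler C c (\<lambda>x y. sweedler C x (\<lambda>u v. sweedler C u f * g v y))"
proof -
  note fg = bilinear_form_functional[OF f] bilinear_form_functional[OF g]
  let ?h = "\<lambda>w. f (w ! 0) (w ! 1) * g (w ! 2) (w ! 3)"
  \<comment> \<open>Reading the letters in the order 1, 3, 0, 2 turns \<open>?h w\<close> into
    \<open>f (w ! 1) (w ! 3) * g (w ! 0) (w ! 2)\<close>. The explicit inverse of this map serves
    for bijectivity.\<close>
  let ?p = "id(0 := 1, 1 := 3, 2 := 0, 3 := 2 :: nat)"
  have lt4: "i < 4 \<longleftrightarrow> i = 0 \<or> i = 1 \<or> i = 2 \<or> i = 3" for i :: nat by auto
  have m: "multilinear C (Suc 3) ?h"
    unfolding multilinear_def by (auto simp: lt4 intro!: functional_intros fg)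
  have p: "?p permutes {..3}"
  proof (rule bij_imp_permutes)
    show "bij_betw ?p {..3} {..3}"
      by (rule bij_betwI[of _ _ _ "id(1 := 0, 3 := 1, 0 := 2, 2 := 3)"]) auto
  qed auto
  have "sweedler C c (\<lambda>x y. sweedler C x (\<lambda>u v. sweedler C u f * g v y)) =
      iter_sweedler 3 c ?h"
    by (simp add: iter_sweedler_snoc eval_nat_numeral sweedler_mult_right)
  also have "\<dots> = iter_sweedler 3 c (\<lambda>w. ?h (permute_list ?p w))"
    by (rule iter_sweedler_permute[OF cocomm m p, symmetric])
  also have "\<dots> = iter_sweedler 3 c (\<lambda>w. g (w ! 0) (w ! 2) * f (w ! 1) (w ! 3))"
    by (rule iter_sweedler_cong) (simp add: permute_list_def mult.commute)
  also have "\<dots> = sweedler C c (\<lambda>u z. sweedler C u (\<lambda>x y. sweedler C x (\<lambda>p v. g p y * f v z)))"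
    by (simp add: iter_sweedler_snoc eval_nat_numeral)
  also have "\<dots> = sweedler C c (\<lambda>x u. sweedler C u (\<lambda>y z. sweedler C x (\<lambda>p v. g p y * f v z)))"
    by (rule sweedler_coassoc; intro functional_sweedler bilinear_formI functional_intros fg)
  also have "\<dots> = sweedler C c (conv C g f)"
    unfolding conv_def by (subst (2) sweedler_commute) simp
  finally show ?thesis ..
qed

end

section \<open>Integer powers of bijections\<close>

lemma map_zpow_add_one:
  assumes "bij T"
  shows "map_zpow T (m + 1) x = T (map_zpow T m x)"
proof (cases "m \<ge> 0")
  case True
  then show ?thesis by (simp add: map_zpow_def nat_add_distrib)
next
  case False
  then have "nat (- m) = Suc (nat (- (m + 1)))" by simp
  with False show ?thesis
    using assms by (auto simp: map_zpow_def bij_is_surj surj_f_inv_f)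
qed

lemma map_zpow_0 [simp]: "map_zpow T 0 x = x"
  by (simp add: map_zpow_def)

lemma map_zpow_commute:
  assumes T: "bij T" and comm: "T \<circ> S = S \<circ> T"
  shows "map_zpow T m (S x) = S (map_zpow T m x)"
proof (induction m rule: int_induct[of _ 0])
  case (step1 i)
  then show ?case
    using comm by (simp add: map_zpow_add_one[OF T] fun_eq_iff)
next
  case (step2 i)
  \<comment> \<open>Downwards, the claim is checked after applying \<open>T\<close>, which
    injectivity then cancels.\<close>
  have "T (map_zpow T (i - 1) (S x)) = T (S (map_zpow T (i - 1) x))"
    using step2 comm map_zpow_add_one[OF T, of "i - 1"] by (simp add: fun_eq_iff)
  then show ?case using T by (meson bij_is_inj injD)
qed simp

text \<open>The hypothesis lowers both indices together and so preserves \<open>p - q\<close>;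
  \<open>q\<close> is driven to 0 from either side.\<close>

lemma antidiagonal_constant:
  assumes "\<And>p q. f p (q + 1) = f (p - 1) q"
  shows "f p q = f (p - q) (0 :: int)"
proof (induction q arbitrary: p rule: int_induct[of _ 0])
  case (step1 i)
  then show ?case using assms[of p i] by (simp add: algebra_simps)
next
  case (step2 i)
  have "f p (i - 1) = f (p + 1) i" using assms[of "p + 1" "i - 1"] by simp
  then show ?case using step2 by (simp add: algebra_simps)
qed simp

section \<open>Products of forms over consecutive pairs of letters, and the identity
  automorphism\<close>

context coalgebra
begin

text \<open>Position \<open>i\<close> occurs only in factor \<open>i div 2\<close>, as first
  argument for even \<open>i\<close> and as second for odd \<open>i\<close>; the other factors are
  constant.\<close>

lemma multilinear_prod_pairs:
  assumes "\<And>k. k < n \<Longrightarrow> bilinear_form C (g k)"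
  shows "multilinear C (2 * n) (\<lambda>w. \<Prod>k<n. g k (w ! (2 * k)) (w ! Suc (2 * k)))"
  unfolding multilinear_def
proof (intro allI impI)
  fix w :: "'c list" and i
  assume w: "length w = 2 * n" and i: "i < 2 * n"
  let ?k = "i div 2"
  let ?r = "\<Prod>k\<in>{..<n} - {?k}. g k (w ! (2 * k)) (w ! Suc (2 * k))"
  have k: "?k < n" using i by simp
  have "(\<Prod>k<n. g k (w[i := x] ! (2 * k)) (w[i := x] ! Suc (2 * k))) =
      g ?k (w[i := x] ! (2 * ?k)) (w[i := x] ! Suc (2 * ?k)) * ?r" for x
  proof (subst prod.remove[of _ ?k])
    show "g ?k (w[i := x] ! (2 * ?k)) (w[i := x] ! Suc (2 * ?k)) *
        (\<Prod>k\<in>{..<n} - {?k}. g k (w[i := x] ! (2 * k)) (w[i := x] ! Suc (2 * k))) =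
      g ?k (w[i := x] ! (2 * ?k)) (w[i := x] ! Suc (2 * ?k)) * ?r"
      by (intro arg_cong2[of _ _ _ _ "(*)"] prod.cong refl) (auto simp: nth_list_update)
  qed (use k in auto)
  moreover have "functional C (\<lambda>x. g ?k (w[i := x] ! (2 * ?k)) (w[i := x] ! Suc (2 * ?k)))"
  proof (cases "even i")
    case True
    then have "2 * ?k = i" by simp
    then show ?thesis using bilinear_form_left[OF assms[OF k]] w i by simp
  next
    case False
    then have "Suc (2 * ?k) = i" by simp
    moreover from this have "2 * ?k \<noteq> i" by linarith
    ultimately show ?thesis using bilinear_form_right[OF assms[OF k]] w i by simp
  qed
  ultimately show "functional C
      (\<lambda>x. \<Prod>k<n. g k (w[i := x] ! (2 * k)) (w[i := x] ! Suc (2 * k)))"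
    by (simp add: functional_mult_right)
qed

text \<open>Taking the identity as one of two automorphisms specializes the lemmas below to maps
  acting on one argument only.\<close>

lemma coalgebra_automorphism_id: "coalgebra_automorphism C S id"
  by (simp add: coalgebra_automorphism_def Vector_Spaces.linear_iff vector_space_axioms)

end

context oriented_quantum_coalgebra
begin

section \<open>The automorphisms of a cocommutative quantum coalgebra\<close>

abbreviation b_inv :: "'c \<Rightarrow> 'c \<Rightarrow> 'k" where
  "b_inv \<equiv> conv_inv C b"

lemma bilinear_b_inv: "bilinear_form C b_inv"
  and conv_b_inv_left: "conv C b_inv b = conv_one C"
  and conv_b_inv_right: "conv C b b_inv = conv_one C"
  using is_conv_inverse_conv_inv[OF bilinear invertible] by (auto simp: is_conv_inverse_def)

text \<open>An automorphism respects the coproduct only as seen by products of two forms from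
  \<open>{b, b_inv}\<close>, and the convolution of \<open>g\<close> and \<open>h\<close> is such a
  product in each argument. Hence \<open>T\<close> and \<open>S\<close> move out of the sums, where
  the counit absorbs them.\<close>

lemma conv_automorphism:
  assumes T: "coalgebra_automorphism C {b, b_inv} T" and S: "coalgebra_automorphism C {b, b_inv} S"
    and g: "g \<in> {b, b_inv}" and h: "h \<in> {b, b_inv}" and gh: "conv C g h = conv_one C"
  shows "conv C (\<lambda>c d. g (T c) (S d)) (\<lambda>c d. h (T c) (S d)) = conv_one C"
proof (intro ext)
  fix c d
  have S2: "sweedler C d (\<lambda>u v. g x (S u) * h y (S v)) = sweedler C (S d) (\<lambda>u v. g x u * h y v)"
    for x y using S g h unfolding coalgebra_automorphism_def by blast
  have T2: "sweedler C c (\<lambda>x y. g (T x) u * h (T y) v) = sweedler C (T c) (\<lambda>x y. g x u * h y v)"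
    for u v using T g h unfolding coalgebra_automorphism_def by blast
  have "conv C (\<lambda>c d. g (T c) (S d)) (\<lambda>c d. h (T c) (S d)) c d =
      sweedler C (S d) (\<lambda>u v. sweedler C c (\<lambda>x y. g (T x) u * h (T y) v))"
    unfolding conv_def S2 by (rule sweedler_commute)
  also have "\<dots> = conv C g h (T c) (S d)"
    unfolding T2 conv_def by (rule sweedler_commute)
  also have "\<dots> = conv_one C c d"
    using T S by (simp add: gh conv_one_def coalgebra_automorphism_def fun_eq_iff)
  finally show "conv C (\<lambda>c d. g (T c) (S d)) (\<lambda>c d. h (T c) (S d)) c d = conv_one C c d" .
qed

lemma bilinear_automorphism:
  assumes "coalgebra_automorphism C A T" "coalgebra_automorphism C A S" "bilinear_form C g"
  shows "bilinear_form C (\<lambda>c d. g (T c) (S d))"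
proof -
  have lin: "R (x + y) = R x + R y" "R (smult C r x) = smult C r (R x)"
    if "coalgebra_automorphism C A R" for R x y r
    using that unfolding coalgebra_automorphism_def Vector_Spaces.linear_iff by blast+
  show ?thesis
    using assms(3) unfolding bilinear_form_iff functional_iff
    by (simp add: lin[OF assms(1)] lin[OF assms(2)])
qed

text \<open>Composing \<open>b_inv\<close> with \<open>T\<close> in both arguments gives an inverse
  of \<open>b\<close> composed with \<open>T\<close>, which is \<open>b\<close> itself.\<close>

lemma b_inv_invariant:
  assumes T: "coalgebra_automorphism C {b, b_inv} T" and inv: "\<And>c d. b (T c) (T d) = b c d"
  shows "b_inv (T c) (T d) = b_inv c d"
proof -
  have "(\<lambda>c d. b_inv (T c) (T d)) = b_inv"
    by (rule conv_inverse_unique[OF bilinear])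
      (use conv_automorphism[OF T T, of b_inv b] bilinear_automorphism[OF T T bilinear_b_inv]
        in \<open>auto simp: inv bilinear_b_inv conv_b_inv_left conv_b_inv_right\<close>)
  then show ?thesis by (rule fun_cong[OF fun_cong])
qed

section \<open>Forms attached to crossing signs, and integer convolution powers\<close>

definition signed_form :: "int \<Rightarrow> 'c \<Rightarrow> 'c \<Rightarrow> 'k" where
  "signed_form s = (if s = 1 then b else b_inv)"

lemma bilinear_signed_form: "bilinear_form C (signed_form s)"
  by (simp add: signed_form_def bilinear bilinear_b_inv)

lemma bilinear_conv_pow: "bilinear_form C (conv_pow C b m)"
  by (simp add: conv_pow_def bilinear_form_conv_npow bilinear bilinear_b_inv)

lemma conv_b_conv_pow: "conv C b (conv_pow C b m) = conv_pow C b (m + 1)"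
proof (cases "m \<ge> 0")
  case True
  then show ?thesis by (simp add: conv_pow_def nat_add_distrib)
next
  case False
  \<comment> \<open>For negative \<open>m\<close> the power starts with a factor
    \<open>b_inv\<close>, which \<open>b\<close> cancels.\<close>
  then have "nat (- m) = Suc (nat (- (m + 1)))" by simp
  with False show ?thesis
    by (auto simp: conv_pow_def bilinear bilinear_b_inv conv_b_inv_right
        bilinear_form_conv_npow conv_conv_inverse)
qed

lemma conv_b_inv_conv_pow: "conv C b_inv (conv_pow C b m) = conv_pow C b (m - 1)"
proof -
  have "conv C b_inv (conv C b (conv_pow C b (m - 1))) = conv_pow C b (m - 1)"
    by (intro conv_conv_inverse bilinear bilinear_b_inv conv_b_inv_left bilinear_conv_pow)
  then show ?thesis by (simp add: conv_b_conv_pow)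
qed

lemma conv_signed_form:
  "s \<in> {1, - 1} \<Longrightarrow> conv C (signed_form s) (conv_pow C b m) = conv_pow C b (m + s)"
  using conv_b_conv_pow conv_b_inv_conv_pow by (auto simp: signed_form_def)

lemma bij_Td: "bij Td" and bij_Tu: "bij Tu"
  using automorphism_Td automorphism_Tu by (auto simp: coalgebra_automorphism_def)

context
  assumes cocomm: "cocommutative C"
begin

text \<open>
  By cocommutativity (qc.1) says that \<open>b c (Tu d)\<close> is convolution inverse to \<open>b_inv (Td c) d\<close>,
  as is \<open>b (Td c) d\<close>.
\<close>

lemma adjoint_b: "b (Td c) d = b c (Tu d)"
proof -
  note [simp] = bilinear_automorphism[OF automorphism_Td coalgebra_automorphism_id, simplified]
    bilinear_automorphism[OF coalgebra_automorphism_id automorphism_Tu, simplified]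
    bilinear bilinear_b_inv
  have "conv C (\<lambda>c d. b c (Tu d)) (\<lambda>c d. b_inv (Td c) d) = conv_one C"
  proof (intro ext)
    fix c d
    \<comment> \<open>In (qc.1) the two factors of \<open>d\<close> stand in the wrong order for a
      convolution; bilinearity in them allows the swap by cocommutativity.\<close>
    have bil: "bilinear_form C (\<lambda>u v. b x (Tu v) * b_inv (Td y) u)" for x y
      by (intro bilinear_formI functional_mult_left functional_mult_right)
        (use bilinear_form_right[of "\<lambda>c d. b c (Tu d)"]
          bilinear_form_right[of b_inv] in auto)
    show "conv C (\<lambda>c d. b c (Tu d)) (\<lambda>c d. b_inv (Td c) d) c d = conv_one C c d"
      using qc1(1)[of c d] unfolding conv_def conv_one_def
      by (subst (asm) sweedler_cocommutative[OF cocomm bil])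
  qed
  then have "(\<lambda>c d. b c (Tu d)) = (\<lambda>c d. b (Td c) d)"
    by (rule conv_inverse_unique[of "\<lambda>c d. b_inv (Td c) d", rotated 3])
      (use conv_automorphism[OF automorphism_Td coalgebra_automorphism_id, of b_inv b]
        in \<open>auto simp: conv_b_inv_left\<close>)
  then show ?thesis by (rule fun_cong[OF fun_cong, symmetric])
qed

text \<open>The left side inverts \<open>b (Td c) d\<close>, the right side inverts
  \<open>b c (Tu d)\<close>, and these agree by \<open>adjoint_b\<close>.\<close>

lemma adjoint_b_inv: "b_inv (Td c) d = b_inv c (Tu d)"
proof -
  have "(\<lambda>c d. b_inv (Td c) d) = (\<lambda>c d. b_inv c (Tu d))"
  proof (rule conv_inverse_unique[of "\<lambda>c d. b (Td c) d"])
    show "conv C (\<lambda>c d. b_inv (Td c) d) (\<lambda>c d. b (Td c) d) = conv_one C"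
      using conv_automorphism[OF automorphism_Td coalgebra_automorphism_id, of b_inv b]
      by (simp add: conv_b_inv_left)
    show "conv C (\<lambda>c d. b (Td c) d) (\<lambda>c d. b_inv c (Tu d)) = conv_one C"
      using conv_automorphism[OF coalgebra_automorphism_id automorphism_Tu, of b b_inv]
      by (simp add: conv_b_inv_right adjoint_b)
  qed (use bilinear_automorphism[OF automorphism_Td coalgebra_automorphism_id]
      bilinear_automorphism[OF coalgebra_automorphism_id automorphism_Tu]
      bilinear bilinear_b_inv in simp_all)
  then show ?thesis by (rule fun_cong[OF fun_cong])
qed

text \<open>Adjointness and invariance make \<open>Td \<circ> Tu\<close> invisible in either
  argument, for instance \<open>g (Td (Tu z)) w = g (Tu z) (Tu w) = g z w\<close>. Both arguments
  thus reduce to the same power of \<open>Td\<close>, which invariance removes.\<close>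

lemma power_invariance:
  assumes g: "g \<in> {b, b_inv}" and pqrs: "p - q = r - s"
  shows "g ((map_zpow Td p \<circ> map_zpow Tu q) x) ((map_zpow Td r \<circ> map_zpow Tu s) y) = g x y"
proof -
  have adj: "g (Td c) d = g c (Tu d)" for c d
    using g adjoint_b adjoint_b_inv by auto
  have d: "g (Td c) (Td d) = g c d" for c d
    using g qc2(1) b_inv_invariant[OF automorphism_Td] by auto
  have u: "g (Tu c) (Tu d) = g c d" for c d
    using g qc2(2) b_inv_invariant[OF automorphism_Tu] by auto
  \<comment> \<open>\<open>h\<close> stands for \<open>g\<close> with the other argument
    fixed.\<close>
  have collapse: "h (map_zpow Td p (map_zpow Tu q z)) = h (map_zpow Td (p - q) z)"
    if h: "\<And>z. h (Td (Tu z)) = h z" for h :: "'c \<Rightarrow> 'k" and p q z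
  proof -
    have "h (Tu (Td z)) = h z" for z
      using h commute by (metis comp_apply)
    then have "h (map_zpow Td p (map_zpow Tu (q + 1) z)) = h (map_zpow Td (p - 1) (map_zpow Tu q z))"
      for p q
      using map_zpow_add_one[OF bij_Td, of "p - 1"] map_zpow_commute[OF bij_Td commute]
      by (simp add: map_zpow_add_one[OF bij_Tu])
    from antidiagonal_constant[of "\<lambda>p q. h (map_zpow Td p (map_zpow Tu q z))", OF this]
    show ?thesis by simp
  qed
  have diag: "g (map_zpow Td k x) (map_zpow Td k y) = g x y" for k
  proof (induction k rule: int_induct[of _ 0])
    case (step1 i)
    then show ?case by (simp add: map_zpow_add_one[OF bij_Td] d)
  next
    case (step2 i)
    then show ?case
      using map_zpow_add_one[OF bij_Td, of "i - 1"] by (simp add: d)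
  qed simp
  have "g ((map_zpow Td p \<circ> map_zpow Tu q) x) ((map_zpow Td r \<circ> map_zpow Tu s) y) =
      g (map_zpow Td (p - q) x) (map_zpow Td (r - s) y)"
  proof -
    have "g (Td (Tu z)) w = g z w" for z w by (simp add: adj u)
    moreover have "g w (Td (Tu z)) = g w z" for z w
      using commute by (simp add: fun_eq_iff d flip: adj)
    ultimately show ?thesis
      by (simp add: collapse[of "\<lambda>z. g z _"] collapse[of "g _"])
  qed
  with pqrs diag show ?thesis by simp
qed

section \<open>Products over disjoint pairs of tensor factors\<close>

text \<open>Induction peels off the last pair of letters; \<open>sweedler_conv\<close> merges its
  form with the power collected from the earlier pairs. There are \<open>Suc n\<close> pairs, that
  is 2n + 2 letters, hence \<open>Suc (2 * n)\<close> coproducts.\<close>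

lemma iter_sweedler_signed_forms:
  assumes "\<And>k. k \<le> n \<Longrightarrow> s k \<in> {1, - 1}"
  shows "iter_sweedler (Suc (2 * n)) c
      (\<lambda>w. \<Prod>k<Suc n. signed_form (s k) (w ! (2 * k)) (w ! Suc (2 * k))) =
    sweedler C c (conv_pow C b (\<Sum>k<Suc n. s k))"
  using assms
proof (induction n arbitrary: c)
  case 0
  have "signed_form (s 0) = conv_pow C b (s 0)"
    using conv_signed_form[of "s 0" 0] 0
    by (simp add: conv_pow_def[of _ _ 0] conv_one_right bilinear_signed_form)
  then show ?case by (simp add: iter_sweedler_snoc)
next
  case (Suc n)
  let ?F = "\<lambda>n w. \<Prod>k<Suc n. signed_form (s k) (w ! (2 * k)) (w ! Suc (2 * k))"
  have split: "iter_sweedler (Suc (2 * n)) u (\<lambda>w. ?F (Suc n) ((w @ [v]) @ [y])) =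
      iter_sweedler (Suc (2 * n)) u (\<lambda>w. ?F n w * signed_form (s (Suc n)) v y)" for u v y
  proof (rule iter_sweedler_cong)
    fix w :: "'c list" assume w: "length w = Suc (Suc (2 * n))"
    have "?F n ((w @ [v]) @ [y]) = ?F n w"
      by (rule prod.cong) (auto simp: nth_append w)
    moreover have "((w @ [v]) @ [y]) ! (2 * Suc n) = v" "((w @ [v]) @ [y]) ! Suc (2 * Suc n) = y"
      by (simp_all add: nth_append w)
    ultimately show "?F (Suc n) ((w @ [v]) @ [y]) = ?F n w * signed_form (s (Suc n)) v y"
      by (simp only: prod.lessThan_Suc[of _ "Suc n"])
  qed
  have "iter_sweedler (Suc (2 * Suc n)) c (?F (Suc n)) = sweedler C c (\<lambda>x y.
      sweedler C x (\<lambda>u v. iter_sweedler (Suc (2 * n)) u (\<lambda>w. ?F (Suc n) ((w @ [v]) @ [y]))))"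
    by (simp only: mult_Suc_right add_2_eq_Suc iter_sweedler_snoc[of "Suc (Suc (2 * n))"]
        iter_sweedler_snoc[of "Suc (2 * n)"])
  also have "\<dots> = sweedler C c (\<lambda>x y. sweedler C x (\<lambda>u v.
      sweedler C u (conv_pow C b (\<Sum>k<Suc n. s k)) * signed_form (s (Suc n)) v y))"
    unfolding split iter_sweedler_mult_right using Suc by simp
  also have "\<dots> = sweedler C c (conv C (signed_form (s (Suc n))) (conv_pow C b (\<Sum>k<Suc n. s k)))"
    by (intro sweedler_conv[symmetric] cocomm bilinear_conv_pow bilinear_signed_form)
  also have "\<dots> = sweedler C c (conv_pow C b (\<Sum>k<Suc (Suc n). s k))"
    using Suc.prems by (simp add: conv_signed_form)
  finally show ?case .
qed

end

end

section \<open>Points and segments of a diagram\<close>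

text \<open>\<open>lower_point\<close> and \<open>upper_point\<close> number the points of a level
  by counting the ends of the pieces further left. Points are therefore positions in a concatenation
  of blocks, the subject of this and the next two lemmas.\<close>

lemma nth_concat_map:
  assumes "p < length xs" "j < length (f (xs ! p))"
  shows "concat (map f xs) ! (length (concat (map f (take p xs))) + j) = f (xs ! p) ! j"
proof -
  have "concat (map f xs) =
      concat (map f (take p xs)) @ f (xs ! p) @ concat (map f (drop (Suc p) xs))"
    using id_take_nth_drop[OF assms(1)] by (metis concat.simps(2) concat_append list.simps(9) map_append)
  then show ?thesis using assms(2) by (simp add: nth_append)
qed

lemma concat_map_position_inj:
  assumes "p < length xs" "q < length xs" "j < length (f (xs ! p))" "l < length (f (xs ! q))"
    and "length (concat (map f (take p xs))) + j = length (concat (map f (take q xs))) + l"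
  shows "p = q \<and> j = l"
  using assms
proof (induction xs arbitrary: p q)
  case (Cons x xs)
  then show ?case by (cases p; cases q) auto
qed simp

lemma concat_map_position_surj:
  assumes "i < length (concat (map f xs))"
  obtains p j where "p < length xs" "j < length (f (xs ! p))"
    "i = length (concat (map f (take p xs))) + j"
  using assms
proof (induction xs arbitrary: i thesis)
  case (Cons x xs)
  show ?case
  proof (cases "i < length (f x)")
    case True
    then show ?thesis using Cons.prems(1)[of 0 i] by simp
  next
    case False
    then have "i - length (f x) < length (concat (map f xs))" using Cons.prems(2) by simp
    from Cons.IH[OF _ this] obtain p j where "p < length xs" "j < length (f (xs ! p))"
      "i - length (f x) = length (concat (map f (take p xs))) + j" by blast
    with False show ?thesis using Cons.prems(1)[of "Suc p" j] by simp
  qed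
qed simp

text \<open>The top level has no row above it, so its direction is read from the last row.\<close>

definition point_direction :: "diagram \<Rightarrow> nat \<times> nat \<Rightarrow> vdir" where
  "point_direction D P = (case P of (h, i) \<Rightarrow>
     if h < length D then row_lower (D ! h) ! i else row_upper (last D) ! i)"

lemma finite_locations: "finite (locations D)"
proof -
  have "locations D = (\<Union>h<length D. Pair h ` {..<length (D ! h)})"
    by (auto simp: locations_def)
  then show ?thesis by simp
qed

lemma finite_crossings: "finite (crossings D)"
  using finite_locations by (rule finite_subset[rotated]) (auto simp: crossings_def)

fun segment_location :: "segment \<Rightarrow> location" where
  "segment_location (Arc x) = x"
| "segment_location (Line x m) = x"

lemma segment_location: "s \<in> segments D \<Longrightarrow> segment_location s \<in> locations D"
  by (auto simp: segments_def crossings_def)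

lemma segment_cases:
  assumes "s \<in> segments D"
  obtains (vertical) x d where "s = Arc x" "piece_at D x = Vertical d"
  | (maximum) x a where "s = Arc x" "piece_at D x = Maximum a"
  | (minimum) x a where "s = Arc x" "piece_at D x = Minimum a"
  | (line) x m l d e where "s = Line x m" "x \<in> crossings D" "piece_at D x = Crossing l d e"
proof (cases s)
  case (Arc x)
  with assms have "x \<in> locations D" "x \<notin> crossings D" by (auto simp: segments_def)
  with Arc that(1-3) show ?thesis
    by (cases "piece_at D x") (auto simp: crossings_def)
next
  case (Line x m)
  with assms have x: "x \<in> crossings D" by (auto simp: segments_def)
  then obtain l d e where "piece_at D x = Crossing l d e" by (auto simp: crossings_def)
  with Line x show ?thesis by (rule that(4))
qed

lemma point_direction_lower:
  assumes "x \<in> locations D" "i < length (lower_ends (piece_at D x))"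
  shows "point_direction D (lower_point D x i) = lower_ends (piece_at D x) ! i"
  using assms
  by (auto simp: point_direction_def lower_point_def piece_at_def locations_def row_lower_def
      nth_concat_map split: prod.splits)

lemma point_direction_upper:
  assumes D: "compatible D" and x: "x \<in> locations D" and i: "i < length (upper_ends (piece_at D x))"
  shows "point_direction D (upper_point D x i) = upper_ends (piece_at D x) ! i"
proof -
  obtain h p where hp: "x = (h, p)" "h < length D" "p < length (D ! h)"
    using x by (auto simp: locations_def)
  have "row_upper (D ! h) ! (length (row_upper (take p (D ! h))) + i) = upper_ends (piece_at D x) ! i"
    using hp i by (simp add: row_upper_def piece_at_def nth_concat_map)
  moreover have "row_lower (D ! Suc h) = row_upper (D ! h)" if "Suc h < length D"
    using D that by (simp add: compatible_def)
  moreover have "last D = D ! h" if "\<not> Suc h < length D"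
    using hp(2) that by (metis last_conv_nth Suc_lessI diff_Suc_1 list.size(3) not_less_zero)
  ultimately show ?thesis
    by (simp add: point_direction_def upper_point_def hp)
qed

lemma lower_point_inj:
  assumes "x \<in> locations D" "y \<in> locations D"
    and "i < length (lower_ends (piece_at D x))" "j < length (lower_ends (piece_at D y))"
    and "lower_point D x i = lower_point D y j"
  shows "x = y"
  using assms concat_map_position_inj[of "snd x" "D ! fst x" "snd y" i lower_ends j]
  by (auto simp: lower_point_def locations_def piece_at_def row_lower_def)

lemma upper_point_inj:
  assumes "x \<in> locations D" "y \<in> locations D"
    and "i < length (upper_ends (piece_at D x))" "j < length (upper_ends (piece_at D y))"
    and "upper_point D x i = upper_point D y j"
  shows "x = y"
  using assms concat_map_position_inj[of "snd x" "D ! fst x" "snd y" i upper_ends j]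
  by (auto simp: upper_point_def locations_def piece_at_def row_upper_def)

text \<open>\<open>Up\<close> at a lower end and \<open>Down\<close> at an upper end are the
  directions that point into the piece.\<close>

lemma segment_start:
  assumes "s \<in> segments D" and "x = segment_location s"
  obtains (lower) i where "i < length (lower_ends (piece_at D x))" "lower_ends (piece_at D x) ! i = Up"
      "fst (ends D s) = lower_point D x i"
  | (upper) i where "i < length (upper_ends (piece_at D x))" "upper_ends (piece_at D x) ! i = Down"
      "fst (ends D s) = upper_point D x i"
  using assms(1)
proof (cases s rule: segment_cases)
  case (vertical y d)
  then show ?thesis using that(1)[of 0] that(2)[of 0] assms(2)
    by (cases d) (auto simp: directed_def)
next
  case (maximum y a)
  then show ?thesis using that(1)[of 0] that(1)[of 1] assms(2) by (cases a) auto
next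
  case (minimum y a)
  then show ?thesis using that(2)[of 0] that(2)[of 1] assms(2) by (cases a) auto
next
  case (line y m l d e)
  then show ?thesis
    using that(1)[of 0] that(1)[of 1] that(2)[of 0] that(2)[of 1] assms(2)
    by (cases m; cases d; cases e) (auto simp: directed_def)
qed

lemma segment_finish:
  assumes "s \<in> segments D" and "x = segment_location s"
  obtains (upper) i where "i < length (upper_ends (piece_at D x))" "upper_ends (piece_at D x) ! i = Up"
      "snd (ends D s) = upper_point D x i"
  | (lower) i where "i < length (lower_ends (piece_at D x))" "lower_ends (piece_at D x) ! i = Down"
      "snd (ends D s) = lower_point D x i"
  using assms(1)
proof (cases s rule: segment_cases)
  case (vertical y d)
  then show ?thesis using that(1)[of 0] that(2)[of 0] assms(2)
    by (cases d) (auto simp: directed_def)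
next
  case (maximum y a)
  then show ?thesis using that(2)[of 0] that(2)[of 1] assms(2) by (cases a) auto
next
  case (minimum y a)
  then show ?thesis using that(1)[of 0] that(1)[of 1] assms(2) by (cases a) auto
next
  case (line y m l d e)
  then show ?thesis
    using that(1)[of 0] that(1)[of 1] that(2)[of 0] that(2)[of 1] assms(2)
    by (cases m; cases d; cases e) (auto simp: directed_def)
qed

lemma segment_start_direction:
  assumes "compatible D" "s \<in> segments D" "x = segment_location s"
  obtains (lower) i where "point_direction D (fst (ends D s)) = Up"
      "i < length (lower_ends (piece_at D x))" "fst (ends D s) = lower_point D x i"
  | (upper) i where "point_direction D (fst (ends D s)) = Down"
      "i < length (upper_ends (piece_at D x))" "fst (ends D s) = upper_point D x i"
proof -
  have x: "x \<in> locations D" using segment_location[OF assms(2)] assms(3) by simp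
  show ?thesis
    using assms(2,3)
  proof (cases rule: segment_start)
    case (lower i)
    with that(1)[of i] point_direction_lower[OF x, of i] show ?thesis by simp
  next
    case (upper i)
    with that(2)[of i] point_direction_upper[OF assms(1) x, of i] show ?thesis by simp
  qed
qed

text \<open>The direction at the starting point tells whether the segment leaves it upwards from a
  lower end or downwards from an upper end. So the point determines the piece, and the two lines of
  a crossing start at different points.\<close>

lemma inj_on_segment_start:
  assumes D: "compatible D"
  shows "inj_on (fst \<circ> ends D) (segments D)"
proof (rule inj_onI, unfold comp_apply)
  fix s t assume s: "s \<in> segments D" and t: "t \<in> segments D"
    and eq: "fst (ends D s) = fst (ends D t)"
  note loc = segment_location[OF s] segment_location[OF t]
  have "segment_location s = segment_location t"
    using D s refl[of "segment_location s"]
  proof (cases rule: segment_start_direction)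
    case s: (lower i)
    show ?thesis
      using D t refl[of "segment_location t"]
      by (cases rule: segment_start_direction) (use s eq lower_point_inj[OF loc] in auto)
  next
    case s: (upper i)
    show ?thesis
      using D t refl[of "segment_location t"]
      by (cases rule: segment_start_direction) (use s eq upper_point_inj[OF loc] in auto)
  qed
  note eq' = this eq
  show "s = t"
    using s
  proof (cases rule: segment_cases)
  case vertical
  with eq' show ?thesis
    by (cases rule: segment_cases[OF t])
      (auto simp: directed_def lower_point_def upper_point_def split: prod.splits
        vdir.splits hdir.splits diagonal.splits)
  next
  case maximum
  with eq' show ?thesis
    by (cases rule: segment_cases[OF t])
      (auto simp: directed_def lower_point_def upper_point_def split: prod.splits
        vdir.splits hdir.splits diagonal.splits)
  next
  case minimum
  with eq' show ?thesis
    by (cases rule: segment_cases[OF t])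
      (auto simp: directed_def lower_point_def upper_point_def split: prod.splits
        vdir.splits hdir.splits diagonal.splits)
  next
  case line
  with eq' show ?thesis
    by (cases rule: segment_cases[OF t])
      (auto simp: directed_def lower_point_def upper_point_def split: prod.splits
        vdir.splits hdir.splits diagonal.splits)
  qed
qed

text \<open>A converse of \<open>segment_start\<close>; with its counterpart for upper ends it
  supplies the segment at the base point.\<close>

lemma lower_point_starts_segment:
  assumes "x \<in> locations D" "i < length (lower_ends (piece_at D x))"
    "lower_ends (piece_at D x) ! i = Up"
  shows "\<exists>s\<in>segments D. fst (ends D s) = lower_point D x i"
proof (cases "x \<in> crossings D")
  case True
  then obtain l d e where p: "piece_at D x = Crossing l d e" by (auto simp: crossings_def)
  then have "fst (ends D (Line x (if i = 0 then SWNE else NWSE))) = lower_point D x i"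
    using assms(2,3) by (auto simp: directed_def less_Suc_eq)
  with True show ?thesis unfolding segments_def by blast
next
  case False
  then have "Arc x \<in> segments D" using assms(1) by (auto simp: segments_def)
  moreover have "fst (ends D (Arc x)) = lower_point D x i"
    using False assms
    by (cases "piece_at D x" rule: lower_ends.cases)
      (auto simp: crossings_def directed_def less_Suc_eq)
  ultimately show ?thesis by blast
qed

lemma upper_point_starts_segment:
  assumes "x \<in> locations D" "i < length (upper_ends (piece_at D x))"
    "upper_ends (piece_at D x) ! i = Down"
  shows "\<exists>s\<in>segments D. fst (ends D s) = upper_point D x i"
proof (cases "x \<in> crossings D")
  case True
  then obtain l d e where p: "piece_at D x = Crossing l d e" by (auto simp: crossings_def)
  then have "fst (ends D (Line x (if i = 0 then NWSE else SWNE))) = upper_point D x i"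
    using assms(2,3) by (auto simp: directed_def less_Suc_eq)
  with True show ?thesis unfolding segments_def by blast
next
  case False
  then have "Arc x \<in> segments D" using assms(1) by (auto simp: segments_def)
  moreover have "fst (ends D (Arc x)) = upper_point D x i"
    using False assms
    by (cases "piece_at D x" rule: upper_ends.cases)
      (auto simp: crossings_def directed_def less_Suc_eq)
  ultimately show ?thesis by blast
qed

text \<open>
  The number of upward minus downward points is the same on all levels, so that the two end
  points of the tangle have the same direction.
\<close>

definition flux :: "vdir list \<Rightarrow> int" where
  "flux ds = (\<Sum>d\<leftarrow>ds. case d of Up \<Rightarrow> 1 | Down \<Rightarrow> - 1)"

lemma flux_ends: "flux (lower_ends p) = flux (upper_ends p)"
  by (cases p rule: lower_ends.cases) (auto simp: flux_def split: hdir.splits intro: upper_ends.cases[of p])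

lemma flux_row: "flux (row_lower r) = flux (row_upper r)"
  using flux_ends by (induction r) (auto simp: flux_def row_lower_def row_upper_def)

lemma compatible_end_directions:
  assumes D: "compatible D"
  shows "row_upper (last D) = row_lower (hd D)"
proof -
  have "flux (row_upper (D ! h)) = flux (row_lower (hd D))" if "h < length D" for h
    using that
  proof (induction h)
    case 0
    then show ?case using D by (simp add: compatible_def flux_row hd_conv_nth)
  next
    case (Suc h)
    then have "row_lower (D ! Suc h) = row_upper (D ! h)" using D by (simp add: compatible_def)
    with Suc show ?case by (simp flip: flux_row[of "D ! Suc h"])
  qed
  from this[of "length D - 1"] have "flux (row_upper (last D)) = flux (row_lower (hd D))"
    using D by (simp add: compatible_def last_conv_nth)
  with D show ?thesis
    by (auto simp: compatible_def length_Suc_conv flux_def split: vdir.splits)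
qed

text \<open>The base point is the bottom point of a strand whose ends are directed up, and the top
  point otherwise. A piece touching it from inside the box cannot end a segment there, because the
  direction is wrong, and there is no piece on the other side.\<close>

lemma base_point:
  assumes D: "compatible D"
  obtains s where "s \<in> segments D" "\<And>t. t \<in> segments D \<Longrightarrow> snd (ends D t) \<noteq> fst (ends D s)"
proof -
  have D0: "D \<noteq> []" "hd D = D ! 0" "0 < length D" "last D = D ! (length D - 1)"
    using D by (auto simp: compatible_def hd_conv_nth last_conv_nth)
  obtain d where d: "row_lower (hd D) = [d]" "row_upper (last D) = [d]"
    using D compatible_end_directions[OF D] by (auto simp: compatible_def length_Suc_conv)
  show ?thesis
  proof (cases d)
    case Up
    obtain p i where pi: "p < length (D ! 0)" "i < length (lower_ends (D ! 0 ! p))"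
      "0 = length (concat (map lower_ends (take p (D ! 0)))) + i"
      using d(1) concat_map_position_surj[of 0 lower_ends "D ! 0"]
      by (auto simp: row_lower_def D0)
    then have x: "(0, p) \<in> locations D" "i < length (lower_ends (piece_at D (0, p)))"
      and pt: "lower_point D (0, p) i = (0, 0)"
      using D0 by (auto simp: locations_def piece_at_def lower_point_def row_lower_def)
    have dir: "point_direction D (0, 0) = Up"
      using d Up D0 by (simp add: point_direction_def)
    obtain s where s: "s \<in> segments D" "fst (ends D s) = (0, 0)"
      using lower_point_starts_segment[OF x] point_direction_lower[OF x] dir pt by auto
    moreover have "snd (ends D t) \<noteq> (0, 0)" if t: "t \<in> segments D" for t
      using t refl[of "segment_location t"]
    proof (cases rule: segment_finish)
      case (lower i)
      then show ?thesis
        using dir point_direction_lower[OF segment_location[OF t]] by (metis vdir.distinct(1))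
    qed (simp add: upper_point_def split: prod.splits)
    ultimately show ?thesis using that by metis
  next
    case Down
    let ?h = "length D - 1"
    \<comment> \<open>Levels are numbered from 0 below the first row, so the top level has number
      \<open>length D\<close>.\<close>
    let ?P = "(length D, 0)"
    obtain p i where pi: "p < length (D ! ?h)" "i < length (upper_ends (D ! ?h ! p))"
      "0 = length (concat (map upper_ends (take p (D ! ?h)))) + i"
      using d(2) concat_map_position_surj[of 0 upper_ends "D ! ?h"]
      by (auto simp: row_upper_def D0)
    then have x: "(?h, p) \<in> locations D" "i < length (upper_ends (piece_at D (?h, p)))"
      and pt: "upper_point D (?h, p) i = ?P"
      using D0 by (auto simp: locations_def piece_at_def upper_point_def row_upper_def)
    have dir: "point_direction D ?P = Down"
      using d Down D0 by (simp add: point_direction_def)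
    obtain s where s: "s \<in> segments D" "fst (ends D s) = ?P"
      using upper_point_starts_segment[OF x] point_direction_upper[OF D x] dir pt by auto
    moreover have "snd (ends D t) \<noteq> ?P" if t: "t \<in> segments D" for t
      using t refl[of "segment_location t"]
    proof (cases rule: segment_finish)
      case (upper i)
      then show ?thesis
        using dir point_direction_upper[OF D segment_location[OF t]] by (metis vdir.distinct(1))
    next
      case (lower i)
      then show ?thesis
        using segment_location[OF t] by (auto simp: lower_point_def locations_def)
    qed
    ultimately show ?thesis using that by metis
  qed
qed

section \<open>The traversal\<close>

text \<open>The segment from \<open>base_point\<close> must come first, as a predecessor would end
  where it starts. Afterwards each segment is determined by its starting point.\<close>

lemma traversal_unique:
  assumes D: "compatible D" and ss: "is_traversal D ss" and ts: "is_traversal D ts"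
  shows "ss = ts"
proof -
  obtain s where s: "s \<in> segments D" "\<And>t. t \<in> segments D \<Longrightarrow> snd (ends D t) \<noteq> fst (ends D s)"
    using base_point[OF D] by blast
  have first: "us \<noteq> [] \<and> us ! 0 = s" if "is_traversal D us" for us
  proof -
    obtain i where i: "i < length us" "us ! i = s"
      using s(1) \<open>is_traversal D us\<close> by (metis in_set_conv_nth is_traversal_def)
    have "i = 0"
    proof (cases i)
      case (Suc j)
      with i that have "snd (ends D (us ! j)) = fst (ends D s)" "us ! j \<in> segments D"
        by (auto simp: is_traversal_def)
      with s(2) show ?thesis by blast
    qed simp
    with i show ?thesis by auto
  qed
  have len: "length ss = length ts"
    using ss ts by (metis distinct_card is_traversal_def)
  show ?thesis
  proof (rule nth_equalityI[OF len])
    fix i assume "i < length ss"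
    then show "ss ! i = ts ! i"
    proof (induction i)
      case 0
      then show ?case using first ss ts by simp
    next
      case (Suc i)
      then have "fst (ends D (ss ! Suc i)) = fst (ends D (ts ! Suc i))"
        using ss ts len by (metis Suc_lessD is_traversal_def)
      moreover have "ss ! Suc i \<in> segments D" "ts ! Suc i \<in> segments D"
        using Suc.prems ss ts len by (auto simp: is_traversal_def)
      ultimately show ?case
        using inj_on_segment_start[OF D] unfolding inj_on_def comp_apply by blast
    qed
  qed
qed

lemma is_traversal_traversal:
  assumes "D \<in> Tang"
  shows "is_traversal D (traversal D)"
proof -
  from assms obtain ss where D: "compatible D" and ss: "is_traversal D ss"
    by (auto simp: Tang_def)
  show ?thesis
    unfolding traversal_def by (rule theI[of _ ss]) (auto intro: traversal_unique[OF D] ss)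
qed

text \<open>
  Along the strand a maximum turns the direction from up to down and a minimum from down to up.
  Hence \<open>ud - uu\<close>, which counts maxima minus minima, depends only on the direction of the line.
\<close>

definition height :: "vdir \<Rightarrow> int" where
  "height d = (case d of Up \<Rightarrow> 1 | Down \<Rightarrow> 0)"

definition turning :: "diagram \<Rightarrow> segment \<Rightarrow> int" where
  "turning D s = (case s of Arc x \<Rightarrow>
     (case piece_at D x of Maximum a \<Rightarrow> 1 | Minimum a \<Rightarrow> - 1 | _ \<Rightarrow> 0) | Line x m \<Rightarrow> 0)"

lemma segment_end_directions:
  assumes D: "compatible D" and s: "s \<in> segments D"
  shows "turning D s = height (point_direction D (fst (ends D s))) -
    height (point_direction D (snd (ends D s)))"
  using s
proof (cases s rule: segment_cases)
  case (vertical x d)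
  with point_direction_lower[of x D 0] point_direction_upper[OF D, of x 0] segment_location[OF s]
  show ?thesis by (cases d) (auto simp: turning_def height_def directed_def)
next
  case (maximum x a)
  with point_direction_lower[of x D 0] point_direction_lower[of x D 1] segment_location[OF s]
  show ?thesis by (cases a) (auto simp: turning_def height_def)
next
  case (minimum x a)
  with point_direction_upper[OF D, of x 0] point_direction_upper[OF D, of x 1] segment_location[OF s]
  show ?thesis by (cases a) (auto simp: turning_def height_def)
next
  case (line x m l d e)
  with point_direction_lower[of x D 0] point_direction_lower[of x D 1]
    point_direction_upper[OF D, of x 0] point_direction_upper[OF D, of x 1] segment_location[OF s]
  show ?thesis
    by (cases m; cases d; cases e) (auto simp: turning_def height_def directed_def)
qed

lemma line_start_direction:
  assumes D: "compatible D" and x: "x \<in> crossings D" and p: "piece_at D x = Crossing l d e"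
  shows "point_direction D (fst (ends D (Line x m))) = (case m of SWNE \<Rightarrow> d | NWSE \<Rightarrow> e)"
proof -
  have "x \<in> locations D" using x by (simp add: crossings_def)
  with p point_direction_lower[of x D 0] point_direction_lower[of x D 1]
    point_direction_upper[OF D, of x 0] point_direction_upper[OF D, of x 1]
  show ?thesis by (cases m; cases d; cases e) (auto simp: directed_def)
qed

lemma sum_turning_telescopes:
  assumes "compatible D" "ts \<noteq> []" "set ts \<subseteq> segments D"
    "successively (\<lambda>s t. snd (ends D s) = fst (ends D t)) ts"
  shows "(\<Sum>t\<leftarrow>ts. turning D t) = height (point_direction D (fst (ends D (hd ts)))) -
    height (point_direction D (snd (ends D (last ts))))"
  using assms(2-)
proof (induction ts rule: induct_list012)
  case (3 s t ts)
  then show ?case using segment_end_directions[OF assms(1), of s] by simp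
qed (simp_all add: segment_end_directions[OF assms(1)])

text \<open>Both kinds of maxima enter \<open>ud - uu\<close> with a plus sign and both kinds of
  minima with a minus sign, as in \<open>turning\<close>.\<close>

lemma sum_turning_eq_extrema:
  "(\<Sum>t\<leftarrow>ts. turning D t) =
     int (length (filter (\<lambda>t. \<exists>x. t = Arc x \<and> piece_at D x = Maximum Leftwards) ts)) -
     int (length (filter (\<lambda>t. \<exists>x. t = Arc x \<and> piece_at D x = Minimum Leftwards) ts)) -
     (int (length (filter (\<lambda>t. \<exists>x. t = Arc x \<and> piece_at D x = Minimum Rightwards) ts)) -
      int (length (filter (\<lambda>t. \<exists>x. t = Arc x \<and> piece_at D x = Maximum Rightwards) ts)))"
proof (induction ts)
  case (Cons t ts)
  show ?case
  proof (cases t)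
    case (Arc x)
    show ?thesis
    proof (cases "piece_at D x")
      case (Maximum a)
      then show ?thesis using Cons.IH Arc by (cases a) (simp_all add: turning_def del: split_paired_Ex)
    next
      case (Minimum a)
      then show ?thesis using Cons.IH Arc by (cases a) (simp_all add: turning_def del: split_paired_Ex)
    qed (use Cons.IH Arc in \<open>simp_all add: turning_def del: split_paired_Ex\<close>)
  qed (use Cons.IH in \<open>simp add: turning_def del: split_paired_Ex\<close>)
qed simp

text \<open>The traversal from \<open>s\<close> onwards is again a chain of segments, so its
  turnings telescope. The subtracted term is the same for every \<open>s\<close>.\<close>

lemma ud_minus_uu:
  assumes D: "D \<in> Tang" and s: "s \<in> segments D"
  shows "ud D s - uu D s = height (point_direction D (fst (ends D s))) -
    height (point_direction D (snd (ends D (last (traversal D)))))"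
proof -
  let ?ss = "traversal D"
  let ?ts = "dropWhile (\<lambda>t. t \<noteq> s) ?ss"
  have tr: "is_traversal D ?ss" by (rule is_traversal_traversal[OF D])
  have s': "s \<in> set ?ss" using tr s by (simp add: is_traversal_def)
  then have ne: "?ts \<noteq> []" by (auto simp: dropWhile_eq_Nil_conv)
  have "successively (\<lambda>s t. snd (ends D s) = fst (ends D t)) ?ss"
    using tr by (auto simp: is_traversal_def successively_conv_nth)
  then have "successively (\<lambda>s t. snd (ends D s) = fst (ends D t)) ?ts"
    by (metis successively_append_iff takeWhile_dropWhile_id)
  moreover have "set ?ts \<subseteq> segments D"
    using tr set_dropWhileD by (fastforce simp: is_traversal_def)
  moreover have "hd ?ts = s" using hd_dropWhile[OF ne] by simp
  moreover have "last ?ts = last ?ss"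
    using ne by (metis last_appendR takeWhile_dropWhile_id)
  moreover have "compatible D" using D by (simp add: Tang_def)
  ultimately show ?thesis
    using sum_turning_telescopes[of D ?ts] ne
    by (simp add: ud_def uu_def extrema_after_def sum_turning_eq_extrema)
qed

section \<open>Labels of crossing lines\<close>

lemma crossing_lines:
  assumes "D \<in> Tang"
  shows "distinct (crossing_lines D)"
    and "set (crossing_lines D) = (\<lambda>(x, m). Line x m) ` (crossings D \<times> {SWNE, NWSE})"
proof -
  have tr: "is_traversal D (traversal D)" by (rule is_traversal_traversal[OF assms])
  then show "distinct (crossing_lines D)" by (simp add: crossing_lines_def is_traversal_def)
  show "set (crossing_lines D) = (\<lambda>(x, m). Line x m) ` (crossings D \<times> {SWNE, NWSE})"
    using tr diagonal.exhaust by (auto simp: crossing_lines_def is_traversal_def segments_def image_iff)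
qed

lemma length_crossing_lines:
  assumes "D \<in> Tang"
  shows "length (crossing_lines D) = 2 * card (crossings D)"
proof -
  have "length (crossing_lines D) = card (set (crossing_lines D))"
    using crossing_lines(1)[OF assms] by (simp add: distinct_card)
  also have "\<dots> = card (crossings D \<times> {SWNE, NWSE})"
    unfolding crossing_lines(2)[OF assms] by (rule card_image) (auto simp: inj_on_def)
  finally show ?thesis by (simp add: card_cartesian_product)
qed

lemma bij_betw_line_label:
  assumes "D \<in> Tang"
  shows "bij_betw (line_label D) (set (crossing_lines D)) {..<2 * card (crossings D)}"
proof -
  let ?ls = "crossing_lines D"
  \<comment> \<open>The label is the index of \<open>s\<close> in the list, so \<open>nth\<close>
    inverts it.\<close>
  have nth: "line_label D s < length ?ls \<and> ?ls ! line_label D s = s" if "s \<in> set ?ls" for s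
  proof -
    have "0 < length (dropWhile (\<lambda>t. t \<noteq> s) ?ls)"
      using that by (auto simp: dropWhile_eq_Nil_conv)
    moreover have "length ?ls =
        length (takeWhile (\<lambda>t. t \<noteq> s) ?ls) + length (dropWhile (\<lambda>t. t \<noteq> s) ?ls)"
      by (metis length_append takeWhile_dropWhile_id)
    ultimately have "line_label D s < length ?ls"
      unfolding line_label_def by linarith
    with nth_length_takeWhile[of "\<lambda>t. t \<noteq> s" ?ls] show ?thesis
      unfolding line_label_def by blast
  qed
  then have inj: "inj_on (line_label D) (set ?ls)"
    by (metis inj_onI)
  moreover have "line_label D ` set ?ls = {..<length ?ls}"
    using nth crossing_lines(1)[OF assms]
    by (intro card_subset_eq) (auto simp: card_image[OF inj] distinct_card)
  ultimately show ?thesis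
    by (simp add: bij_betw_def length_crossing_lines[OF assms])
qed

lemma over_line_neq_under_line: "over_line D x \<noteq> under_line D x"
  by (simp add: under_line_def split: diagonal.split)

section \<open>The contribution of one crossing and the product over all crossings\<close>

context oriented_quantum_coalgebra
begin

context
  assumes cocomm: "cocommutative C"
begin

text \<open>The differences of the exponents of \<open>Td\<close> and \<open>Tu\<close> agree for
  lines of equal vertical direction; otherwise that of the upward line is larger by 1. A shift at
  \<open>Td\<close> raises the difference and a shift at \<open>Tu\<close> lowers it, and in each
  mixed case the prescribed shift restores equality, so \<open>power_invariance\<close>
  applies.\<close>

lemma crossing_factor_eq:
  assumes D: "D \<in> Tang" and x: "x \<in> crossings D"
  shows "crossing_factor C b Td Tu D w x = signed_form (crossing_sign D x)
    (w ! line_label D (Line x (over_line D x))) (w ! line_label D (Line x (under_line D x)))"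
proof -
  obtain l d e where p: "piece_at D x = Crossing l d e"
    using x by (auto simp: crossings_def)
  have comp: "compatible D" using D by (simp add: Tang_def)
  define h where "h = height (point_direction D (snd (ends D (last (traversal D)))))"
  have "Line x m \<in> segments D" for m
    unfolding segments_def using x by blast
  then have "ud D (Line x m) - uu D (Line x m) =
      height (case m of SWNE \<Rightarrow> d | NWSE \<Rightarrow> e) - h" for m
    using ud_minus_uu[OF D] line_start_direction[OF comp x p] by (simp add: h_def)
  from this[of SWNE] this[of NWSE]
  have *: "ud D (Line x SWNE) - uu D (Line x SWNE) = height d - h"
    "ud D (Line x NWSE) - uu D (Line x NWSE) = height e - h" by simp_all
  note inv = power_invariance[OF cocomm]
  show ?thesis
    using * by (cases l; cases d; cases e)
      (simp_all add: crossing_factor_def p over_line_def under_line_def bead_def signed_form_def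
        crossing_sign_def line_direction_def to_the_right_def height_def inv
        del: comp_apply)
qed

text \<open>The letters are permuted so that each crossing owns two consecutive ones, over line
  first; \<open>iter_sweedler_permute\<close> makes this harmless and
  \<open>iter_sweedler_signed_forms\<close> adds up the signs.\<close>

lemma Inv_eq_conv_pow:
  assumes D: "D \<in> Tang"
  shows "Inv C b Td Tu D c = sweedler C c (conv_pow C b (writhe D))"
proof (cases "crossings D = {}")
  case True
  then show ?thesis
    \<comment> \<open>Without crossings the power is the convolution unit, and the counit axiom
      collapses its Sweedler sum to the counit.\<close>
    using sweedler_counit_left[OF counit_linear, of c]
    by (simp add: Inv_def writhe_def conv_pow_def conv_one_def[abs_def])
next
  case False
  define n where "n = card (crossings D) - 1"
  have n: "card (crossings D) = Suc n"
    using False finite_crossings[of D] by (simp add: n_def card_gt_0_iff)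
  obtain e where e: "bij_betw e {..<Suc n} (crossings D)"
    using ex_bij_betw_nat_finite[OF finite_crossings[of D]] by (auto simp: n atLeast0LessThan)
  \<comment> \<open>Places 2k and 2k + 1 hold the over and the under line of the crossing
    \<open>e k\<close>.\<close>
  define line where "line j = (let x = e (j div 2)
    in Line x (if even j then over_line D x else under_line D x))" for j
  have inj: "inj_on line {..<2 * Suc n}"
  proof (rule inj_onI)
    fix i j assume ij: "i \<in> {..<2 * Suc n}" "j \<in> {..<2 * Suc n}" and eq: "line i = line j"
    then have "e (i div 2) = e (j div 2)" by (simp add: line_def Let_def)
    moreover have "i div 2 < Suc n" "j div 2 < Suc n" using ij by auto
    ultimately have div: "i div 2 = j div 2"
      using e by (auto simp: bij_betw_def dest: inj_onD)
    moreover have "even i \<longleftrightarrow> even j"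
      using eq div over_line_neq_under_line[of D "e (j div 2)"]
      by (auto simp: line_def Let_def split: if_splits)
    ultimately show "i = j" by (metis even_two_times_div_two odd_two_times_div_two_succ)
  qed
  have "line ` {..<2 * Suc n} \<subseteq> set (crossing_lines D)"
  proof (rule image_subsetI)
    fix j assume "j \<in> {..<2 * Suc n}"
    then have "e (j div 2) \<in> crossings D" using bij_betwE[OF e] by auto
    then show "line j \<in> set (crossing_lines D)"
      unfolding crossing_lines(2)[OF D] line_def Let_def using diagonal.exhaust
      by (auto simp: image_iff)
  qed
  moreover have "card (line ` {..<2 * Suc n}) = card (set (crossing_lines D))"
    by (simp only: card_image[OF inj] distinct_card[OF crossing_lines(1)[OF D]]
        length_crossing_lines[OF D] n card_lessThan)
  ultimately have line: "bij_betw line {..<2 * Suc n} (set (crossing_lines D))"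
    using inj by (simp add: bij_betw_def card_subset_eq)
  \<comment> \<open>\<open>p\<close> sends the place of a line in this enumeration to its label
    along the strand; outside the range it is the identity, as \<open>permutes\<close>
    demands.\<close>
  define p where "p j = (if j < 2 * Suc n then line_label D (line j) else j)" for j
  have "bij_betw p {..<2 * Suc n} {..<2 * Suc n} \<longleftrightarrow>
      bij_betw (line_label D \<circ> line) {..<2 * Suc n} {..<2 * Suc n}"
    by (rule bij_betw_cong) (simp add: p_def)
  then have "bij_betw p {..<2 * Suc n} {..<2 * Suc n}"
    using bij_betw_trans[OF line bij_betw_line_label[OF D]] by (simp add: n)
  then have p: "p permutes {..<2 * Suc n}"
    by (rule bij_imp_permutes) (auto simp: p_def)
  define g where "g k = signed_form (crossing_sign D (e k))" for k
  let ?F = "\<lambda>w. \<Prod>k<Suc n. g k (w ! (2 * k)) (w ! Suc (2 * k))"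
  have "Inv C b Td Tu D c =
      iter_sweedler (Suc (2 * n)) c (\<lambda>w. \<Prod>x\<in>crossings D. crossing_factor C b Td Tu D w x)"
    using False by (simp add: Inv_def iter_sweedler_def n)
  also have "\<dots> = iter_sweedler (Suc (2 * n)) c (\<lambda>w. ?F (permute_list p w))"
  proof (rule iter_sweedler_cong)
    fix w :: "'c list" assume w: "length w = Suc (Suc (2 * n))"
    have "(\<Prod>x\<in>crossings D. crossing_factor C b Td Tu D w x) =
        (\<Prod>k<Suc n. crossing_factor C b Td Tu D w (e k))"
      by (rule prod.reindex_bij_betw[OF e, symmetric])
    also have "\<dots> = ?F (permute_list p w)"
    proof (rule prod.cong[OF refl])
      fix k assume k: "k \<in> {..<Suc n}"
      then have "e k \<in> crossings D" using bij_betwE[OF e] by blast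
      moreover have "permute_list p w ! (2 * k) = w ! line_label D (Line (e k) (over_line D (e k)))"
        "permute_list p w ! Suc (2 * k) = w ! line_label D (Line (e k) (under_line D (e k)))"
        using k p w by (auto simp: permute_list_nth p_def line_def Let_def)
      ultimately show "crossing_factor C b Td Tu D w (e k) =
          g k (permute_list p w ! (2 * k)) (permute_list p w ! Suc (2 * k))"
        by (simp add: crossing_factor_eq[OF D] g_def)
    qed
    finally show "(\<Prod>x\<in>crossings D. crossing_factor C b Td Tu D w x) = ?F (permute_list p w)" .
  qed
  also have "\<dots> = iter_sweedler (Suc (2 * n)) c ?F"
    using multilinear_prod_pairs[of "Suc n" g] p
    by (intro iter_sweedler_permute[OF cocomm])
      (simp_all add: g_def bilinear_signed_form lessThan_Suc_atMost)
  also have "\<dots> = sweedler C c (conv_pow C b (\<Sum>k<Suc n. crossing_sign D (e k)))"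
    unfolding g_def by (rule iter_sweedler_signed_forms[OF cocomm]) (simp add: crossing_sign_def)
  also have "(\<Sum>k<Suc n. crossing_sign D (e k)) = writhe D"
    unfolding writhe_def by (rule sum.reindex_bij_betw[OF e])
  finally show ?thesis .
qed

end

end

theorem mainTheorem5:
  fixes C :: "('k::field, 'c::ab_group_add) coalg"
    and b :: "'c \<Rightarrow> 'c \<Rightarrow> 'k" and Td Tu :: "'c \<Rightarrow> 'c"
  assumes "oriented_quantum_coalgebra C b Td Tu"
    and "cocommutative C"
  shows "(\<forall>T\<in>Tang. \<forall>c. Inv C b Td Tu T c = sweedler C c (conv_pow C b (writhe T))) \<and>
         (\<forall>T\<in>Tang. \<forall>T'\<in>Tang. writhe T = writhe T' \<longrightarrow> Inv C b Td Tu T = Inv C b Td Tu T')"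
  using oriented_quantum_coalgebra.Inv_eq_conv_pow[OF assms] by (auto simp: fun_eq_iff)

end
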